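(* Let $\mathcal L$ be the centerless $N=2$ superconformal Neveu-Schwarz algebra, with bracket $[\cdot,\cdot]$. Every Lie superbialgebra structure on $\mathcal L$ is triangular coboundary; that is, for every linear map $\Delta:\mathcal L\to\mathcal L\otimes\mathcal L$ such that $(\mathcal L,[\cdot,\cdot],\Delta)$ is a Lie superbialgebra, there exists $r\in\mathrm{Im}(1-\tau)\subset\mathcal L\otimes\mathcal L$ such that $\Delta=\Delta_r$ and $c(r)=0$.
   Context: All vector spaces are over $\mathbb C$. $\mathcal L$ is the Lie superalgebra with basis $\{L_m, I_m, G_p^{\pm} \mid m\in\mathbb Z,\ p\in\mathbb Z+\tfrac12\}$, where $L_m,I_m$ are even, $G_p^\pm$ are odd, and for $m,n\in\mathbb Z$, $p,q\in\mathbb Z+\frac12$: $[L_m,L_n]=(m-n)L_{m+n}$, $[I_m,I_n]=0$, $[L_m,I_n]=-nI_{m+n}$, $[L_m,G_p^\pm]=(\frac m2-p)G_{p+m}^\pm$, $[I_m,G_p^\pm]=\pm G_{m+p}^\pm$, $[G_p^+,G_q^-]=2L_{p+q}+(p-q)I_{p+q}$, $[G_p^\pm,G_q^\pm]=0$. Let $L=L_{\bar0}\oplus L_{\bar1}$ be a Lie superalgebra; $[x]\in\mathbb Z_2$ denotes the parity of a homogeneous element $x$. Whenever a parity appears in a formula the element is taken homogeneous, and formulas are extended linearly. The super-twist map is $\tau(x\otimes y)=(-1)^{[x][y]}y\otimes x$ on $L\otimes L$; the super-cyclic map on $L^{\otimes3}$ is $\xi(x_1\otimes x_2\otimes x_3)=(-1)^{[x_1]([x_2]+[x_3])}x_2\otimes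 x_3\otimes x_1$; $1$ denotes an identity map. The adjoint diagonal action of $L$ on $L\otimes L$ is $x*\sum_i a_i\otimes b_i=\sum_i([x,a_i]\otimes b_i+(-1)^{[x][a_i]}a_i\otimes[x,b_i])$. A Lie superbialgebra $(L,[\cdot,\cdot],\Delta)$ is a Lie superalgebra $(L,[\cdot,\cdot])$ with a linear map $\Delta:L\to L\otimes L$ such that (i) $\Delta(L_{\bar i})\subset\sum_{\bar j\in\mathbb Z_2}L_{\bar j}\otimes L_{\bar i-\bar j}$; (ii) $\mathrm{Im}\,\Delta\subset\mathrm{Im}(1-\tau)$; (iii) $(1+\xi+\xi^2)\cdot(1\otimes\Delta)\cdot\Delta=0$; (iv) $\Delta([x,y])=x*\Delta y-(-1)^{[x][y]}y*\Delta x$ for all $x,y\in L$. For $r\in L\otimes L$, $\Delta_r(x)=(-1)^{[r][x]}x*r$ for $x\in L$. For $r=\sum_i a_i\otimes b_i$, $c(r)=[r^{12},r^{13}]+[r^{12},r^{23}]+[r^{13},r^{23}]\in L^{\otimes 3}$, where $[r^{12},r^{13}]=\sum_{i,j}(-1)^{[a_j][b_i]}[a_i,a_j]\otimes b_i\otimes b_j$, $[r^{12},r^{23}]=\sum_{i,j}a_i\otimes[b_i,a_j]\otimes b_j$, $[r^{13},r^{23}]=\sum_{i,j}(-1)^{[a_j][b_i]}a_i\otimes a_j\otimes[b_i,b_j]$. The Lie superbialgebra is coboundary if $\Delta=\Delta_r$ for some $r\in\mathrm{Im}(1-\tau)$, and triangular coboundary if moreover $c(r)=0$ (classical Yang-Baxter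 equation). *)

theory Defs
  imports Complex_Main "HOL-Library.Poly_Mapping" "HOL-Library.Z2"
begin

section \<open>Super vector spaces with a homogeneous basis\<close>

text \<open>
  A complex vector space with basis indexed by the type \<open>'b\<close> is the type \<open>'b \<Rightarrow>\<^sub>0 complex\<close> of
  finitely supported coefficient families.  The tensor product of the spaces with bases \<open>'a\<close> and
  \<open>'b\<close> is \<open>('a \<times> 'b) \<Rightarrow>\<^sub>0 complex\<close>, and the triple tensor power is \<open>('b \<times> 'b \<times> 'b) \<Rightarrow>\<^sub>0 complex\<close>.
  A grading by \<open>\<int>/2\<close> (the field \<open>bit\<close>) is given by a parity function on the basis; a formula stated
  for homogeneous elements and extended linearly is given on basis elements and extended linearly.
\<close>

definition scale :: "complex \<Rightarrow> ('b \<Rightarrow>\<^sub>0 complex) \<Rightarrow> ('b \<Rightarrow>\<^sub>0 complex)" where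
  "scale c x = Poly_Mapping.map ((*) c) x"

abbreviation bas :: "'b \<Rightarrow> ('b \<Rightarrow>\<^sub>0 complex)" where
  "bas b \<equiv> Poly_Mapping.single b 1"

abbreviation lin :: "(('a \<Rightarrow>\<^sub>0 complex) \<Rightarrow> ('b \<Rightarrow>\<^sub>0 complex)) \<Rightarrow> bool" where
  "lin f \<equiv> Vector_Spaces.linear scale scale f"

definition lin_ext :: "('a \<Rightarrow> ('b \<Rightarrow>\<^sub>0 complex)) \<Rightarrow> ('a \<Rightarrow>\<^sub>0 complex) \<Rightarrow> ('b \<Rightarrow>\<^sub>0 complex)" where
  "lin_ext f x = (\<Sum>a\<in>Poly_Mapping.keys x. scale (Poly_Mapping.lookup x a) (f a))"

definition bilin_ext ::
  "('a \<Rightarrow> 'b \<Rightarrow> ('c \<Rightarrow>\<^sub>0 complex)) \<Rightarrow> ('a \<Rightarrow>\<^sub>0 complex) \<Rightarrow> ('b \<Rightarrow>\<^sub>0 complex) \<Rightarrow> ('c \<Rightarrow>\<^sub>0 complex)" where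
  "bilin_ext f x y = lin_ext (\<lambda>a. lin_ext (f a) y) x"

definition tensor ::
  "('a \<Rightarrow>\<^sub>0 complex) \<Rightarrow> ('b \<Rightarrow>\<^sub>0 complex) \<Rightarrow> ('a \<times> 'b \<Rightarrow>\<^sub>0 complex)" (infixr \<open>\<otimes>\<close> 75) where
  "x \<otimes> y = bilin_ext (\<lambda>a b. bas (a, b)) x y"

definition tensor_map ::
  "(('a \<Rightarrow>\<^sub>0 complex) \<Rightarrow> ('c \<Rightarrow>\<^sub>0 complex)) \<Rightarrow> (('b \<Rightarrow>\<^sub>0 complex) \<Rightarrow> ('d \<Rightarrow>\<^sub>0 complex)) \<Rightarrow>
     ('a \<times> 'b \<Rightarrow>\<^sub>0 complex) \<Rightarrow> ('c \<times> 'd \<Rightarrow>\<^sub>0 complex)" where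
  "tensor_map f g = lin_ext (\<lambda>(a, b). f (bas a) \<otimes> g (bas b))"

definition homog :: "('b \<Rightarrow> bit) \<Rightarrow> bit \<Rightarrow> ('b \<Rightarrow>\<^sub>0 complex) set" where
  "homog par i = {x. \<forall>b\<in>Poly_Mapping.keys x. par b = i}"

definition sgn2 :: "bit \<Rightarrow> complex" where
  "sgn2 i = (if i = 1 then - 1 else 1)"


section \<open>Lie superbialgebras\<close>

definition lie_superalgebra ::
  "('b \<Rightarrow> bit) \<Rightarrow> (('b \<Rightarrow>\<^sub>0 complex) \<Rightarrow> ('b \<Rightarrow>\<^sub>0 complex) \<Rightarrow> ('b \<Rightarrow>\<^sub>0 complex)) \<Rightarrow> bool" where
  "lie_superalgebra par br \<longleftrightarrow>
     (\<forall>x. lin (br x)) \<and> (\<forall>y. lin (\<lambda>x. br x y)) \<and>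
     (\<forall>i j. \<forall>x\<in>homog par i. \<forall>y\<in>homog par j. br x y \<in> homog par (i + j)) \<and>
     (\<forall>i j. \<forall>x\<in>homog par i. \<forall>y\<in>homog par j. br x y = - scale (sgn2 (i * j)) (br y x)) \<and>
     (\<forall>i j. \<forall>x\<in>homog par i. \<forall>y\<in>homog par j. \<forall>z.
        br x (br y z) = br (br x y) z + scale (sgn2 (i * j)) (br y (br x z)))"

definition super_twist ::
  "('b \<Rightarrow> bit) \<Rightarrow> ('b \<times> 'b \<Rightarrow>\<^sub>0 complex) \<Rightarrow> ('b \<times> 'b \<Rightarrow>\<^sub>0 complex)" where
  "super_twist par = lin_ext (\<lambda>(a, b). scale (sgn2 (par a * par b)) (bas (b, a)))"

definition super_cyclic ::
  "('b \<Rightarrow> bit) \<Rightarrow> ('b \<times> 'b \<times> 'b \<Rightarrow>\<^sub>0 complex) \<Rightarrow> ('b \<times> 'b \<times> 'b \<Rightarrow>\<^sub>0 complex)" where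
  "super_cyclic par =
     lin_ext (\<lambda>(a, b, c). scale (sgn2 (par a * (par b + par c))) (bas (b, c, a)))"

definition im_one_minus_twist :: "('b \<Rightarrow> bit) \<Rightarrow> ('b \<times> 'b \<Rightarrow>\<^sub>0 complex) set" where
  "im_one_minus_twist par = range (\<lambda>t. t - super_twist par t)"

definition diag_action ::
  "('b \<Rightarrow> bit) \<Rightarrow> (('b \<Rightarrow>\<^sub>0 complex) \<Rightarrow> ('b \<Rightarrow>\<^sub>0 complex) \<Rightarrow> ('b \<Rightarrow>\<^sub>0 complex)) \<Rightarrow>
     ('b \<Rightarrow>\<^sub>0 complex) \<Rightarrow> ('b \<times> 'b \<Rightarrow>\<^sub>0 complex) \<Rightarrow> ('b \<times> 'b \<Rightarrow>\<^sub>0 complex)" where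
  "diag_action par br =
     bilin_ext (\<lambda>x (a, b). br (bas x) (bas a) \<otimes> bas b
                 + scale (sgn2 (par x * par a)) (bas a \<otimes> br (bas x) (bas b)))"

definition lie_superbialgebra ::
  "('b \<Rightarrow> bit) \<Rightarrow> (('b \<Rightarrow>\<^sub>0 complex) \<Rightarrow> ('b \<Rightarrow>\<^sub>0 complex) \<Rightarrow> ('b \<Rightarrow>\<^sub>0 complex)) \<Rightarrow>
     (('b \<Rightarrow>\<^sub>0 complex) \<Rightarrow> ('b \<times> 'b \<Rightarrow>\<^sub>0 complex)) \<Rightarrow> bool" where
  "lie_superbialgebra par br \<Delta> \<longleftrightarrow>
     lie_superalgebra par br \<and> lin \<Delta> \<and>
     (\<forall>i. \<Delta> ` homog par i \<subseteq>
        module.span scale (\<Union>j. {x \<otimes> y | x y. x \<in> homog par j \<and> y \<in> homog par (i - j)})) \<and>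
     range \<Delta> \<subseteq> im_one_minus_twist par \<and>
     (\<forall>x. let t = tensor_map id \<Delta> (\<Delta> x)
          in t + super_cyclic par t + super_cyclic par (super_cyclic par t) = 0) \<and>
     (\<forall>i j. \<forall>x\<in>homog par i. \<forall>y\<in>homog par j.
        \<Delta> (br x y) =
          diag_action par br x (\<Delta> y) - scale (sgn2 (i * j)) (diag_action par br y (\<Delta> x)))"

text \<open>
  The cobracket \<open>\<Delta>\<^sub>r\<close> is defined for every tensor \<open>r\<close>, homogeneous or not: the defining formula
  is extended linearly in \<open>r\<close> as well, a basis tensor \<open>a \<otimes> b\<close> having parity \<open>par a + par b\<close>.
\<close>

definition cobracket_of ::
  "('b \<Rightarrow> bit) \<Rightarrow> (('b \<Rightarrow>\<^sub>0 complex) \<Rightarrow> ('b \<Rightarrow>\<^sub>0 complex) \<Rightarrow> ('b \<Rightarrow>\<^sub>0 complex)) \<Rightarrow>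
     ('b \<times> 'b \<Rightarrow>\<^sub>0 complex) \<Rightarrow> ('b \<Rightarrow>\<^sub>0 complex) \<Rightarrow> ('b \<times> 'b \<Rightarrow>\<^sub>0 complex)" where
  "cobracket_of par br =
     bilin_ext (\<lambda>(a, b) x.
       scale (sgn2 ((par a + par b) * par x)) (diag_action par br (bas x) (bas (a, b))))"

definition r12_r13 ::
  "('b \<Rightarrow> bit) \<Rightarrow> (('b \<Rightarrow>\<^sub>0 complex) \<Rightarrow> ('b \<Rightarrow>\<^sub>0 complex) \<Rightarrow> ('b \<Rightarrow>\<^sub>0 complex)) \<Rightarrow>
     ('b \<times> 'b \<Rightarrow>\<^sub>0 complex) \<Rightarrow> ('b \<times> 'b \<times> 'b \<Rightarrow>\<^sub>0 complex)" where
  "r12_r13 par br r =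
     bilin_ext (\<lambda>(a, b) (a', b').
       scale (sgn2 (par a' * par b)) (br (bas a) (bas a') \<otimes> bas b \<otimes> bas b')) r r"

definition r12_r23 ::
  "(('b \<Rightarrow>\<^sub>0 complex) \<Rightarrow> ('b \<Rightarrow>\<^sub>0 complex) \<Rightarrow> ('b \<Rightarrow>\<^sub>0 complex)) \<Rightarrow>
     ('b \<times> 'b \<Rightarrow>\<^sub>0 complex) \<Rightarrow> ('b \<times> 'b \<times> 'b \<Rightarrow>\<^sub>0 complex)" where
  "r12_r23 br r =
     bilin_ext (\<lambda>(a, b) (a', b'). bas a \<otimes> br (bas b) (bas a') \<otimes> bas b') r r"

definition r13_r23 ::
  "('b \<Rightarrow> bit) \<Rightarrow> (('b \<Rightarrow>\<^sub>0 complex) \<Rightarrow> ('b \<Rightarrow>\<^sub>0 complex) \<Rightarrow> ('b \<Rightarrow>\<^sub>0 complex)) \<Rightarrow>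
     ('b \<times> 'b \<Rightarrow>\<^sub>0 complex) \<Rightarrow> ('b \<times> 'b \<times> 'b \<Rightarrow>\<^sub>0 complex)" where
  "r13_r23 par br r =
     bilin_ext (\<lambda>(a, b) (a', b').
       scale (sgn2 (par a' * par b)) (bas a \<otimes> bas a' \<otimes> br (bas b) (bas b'))) r r"

definition cybe ::
  "('b \<Rightarrow> bit) \<Rightarrow> (('b \<Rightarrow>\<^sub>0 complex) \<Rightarrow> ('b \<Rightarrow>\<^sub>0 complex) \<Rightarrow> ('b \<Rightarrow>\<^sub>0 complex)) \<Rightarrow>
     ('b \<times> 'b \<Rightarrow>\<^sub>0 complex) \<Rightarrow> ('b \<times> 'b \<times> 'b \<Rightarrow>\<^sub>0 complex)" where
  "cybe par br r = r12_r13 par br r + r12_r23 br r + r13_r23 par br r"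


section \<open>The centerless N=2 superconformal Neveu-Schwarz algebra\<close>

text \<open>
  The half-integers \<open>p \<in> \<int> + 1/2\<close> are encoded by integers: \<open>GP k\<close> and \<open>GM k\<close> stand for
  \<open>G\<^sup>+\<close> and \<open>G\<^sup>-\<close> with index \<open>p = k + 1/2\<close>.  Hence for \<open>p = k + 1/2\<close> and \<open>q = l + 1/2\<close> we have
  \<open>p + q = k + l + 1\<close> and \<open>p - q = k - l\<close>, while \<open>m + p\<close> is encoded by \<open>m + k\<close>.
\<close>

datatype n2_basis = LL int | II int | GP int | GM int

fun n2_par :: "n2_basis \<Rightarrow> bit" where
  "n2_par (LL m) = 0"
| "n2_par (II m) = 0"
| "n2_par (GP k) = 1"
| "n2_par (GM k) = 1"

abbreviation half_idx :: "int \<Rightarrow> complex" where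
  "half_idx k \<equiv> of_int k + 1 / 2"

text \<open>The brackets of basis elements in the opposite order are given by super skew-symmetry.\<close>

fun n2_bracket_basis :: "n2_basis \<Rightarrow> n2_basis \<Rightarrow> (n2_basis \<Rightarrow>\<^sub>0 complex)" where
  "n2_bracket_basis (LL m) (LL n) = scale (of_int (m - n)) (bas (LL (m + n)))"
| "n2_bracket_basis (II m) (II n) = 0"
| "n2_bracket_basis (LL m) (II n) = scale (- of_int n) (bas (II (m + n)))"
| "n2_bracket_basis (II n) (LL m) = scale (of_int n) (bas (II (m + n)))"
| "n2_bracket_basis (LL m) (GP k) = scale (of_int m / 2 - half_idx k) (bas (GP (k + m)))"
| "n2_bracket_basis (GP k) (LL m) = - scale (of_int m / 2 - half_idx k) (bas (GP (k + m)))"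
| "n2_bracket_basis (LL m) (GM k) = scale (of_int m / 2 - half_idx k) (bas (GM (k + m)))"
| "n2_bracket_basis (GM k) (LL m) = - scale (of_int m / 2 - half_idx k) (bas (GM (k + m)))"
| "n2_bracket_basis (II m) (GP k) = bas (GP (m + k))"
| "n2_bracket_basis (GP k) (II m) = - bas (GP (m + k))"
| "n2_bracket_basis (II m) (GM k) = - bas (GM (m + k))"
| "n2_bracket_basis (GM k) (II m) = bas (GM (m + k))"
| "n2_bracket_basis (GP k) (GM l) =
     scale 2 (bas (LL (k + l + 1))) + scale (of_int (k - l)) (bas (II (k + l + 1)))"
| "n2_bracket_basis (GM l) (GP k) =
     scale 2 (bas (LL (k + l + 1))) + scale (of_int (k - l)) (bas (II (k + l + 1)))"
| "n2_bracket_basis (GP k) (GP l) = 0"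
| "n2_bracket_basis (GM k) (GM l) = 0"

definition n2_bracket ::
  "(n2_basis \<Rightarrow>\<^sub>0 complex) \<Rightarrow> (n2_basis \<Rightarrow>\<^sub>0 complex) \<Rightarrow> (n2_basis \<Rightarrow>\<^sub>0 complex)" where
  "n2_bracket = bilin_ext n2_bracket_basis"


section \<open>The algebra is a Lie superalgebra\<close>

lemma lookup_scale [simp]: "Poly_Mapping.lookup (scale c x) b = c * Poly_Mapping.lookup x b"
  by (simp add: scale_def Poly_Mapping.map.rep_eq when_def)

lemma vector_space_scale: "vector_space (scale :: complex \<Rightarrow> ('b \<Rightarrow>\<^sub>0 complex) \<Rightarrow> _)"
  by unfold_locales (auto intro!: poly_mapping_eqI simp: lookup_add algebra_simps)

lemma lin_iff:
  "lin f \<longleftrightarrow> (\<forall>x y. f (x + y) = f x + f y) \<and> (\<forall>c x. f (scale c x) = scale c (f x))"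
  by (auto simp: Vector_Spaces.linear_iff vector_space_scale)

lemma scale_simps:
  "scale c (x + y) = scale c x + scale c y" "scale c 0 = 0" "scale 0 x = 0" "scale 1 x = x"
  "scale c (- x) = - scale c x" "scale c (scale d x) = scale (c * d) x"
  "scale (- c) x = - scale c x" "scale c (x - y) = scale c x - scale c y"
  by (auto intro!: poly_mapping_eqI simp: lookup_add lookup_minus algebra_simps)

lemma scale_sum: "scale c (sum f A) = (\<Sum>a\<in>A. scale c (f a))"
  by (induction A rule: infinite_finite_induct) (auto simp: scale_simps)

lemma scale_add_left: "scale (c + d) x = scale c x + scale d x"
  by (auto intro!: poly_mapping_eqI simp: lookup_add algebra_simps)

lemma lin_ext_superset:
  assumes "finite A" "Poly_Mapping.keys x \<subseteq> A"
  shows "lin_ext f x = (\<Sum>a\<in>A. scale (Poly_Mapping.lookup x a) (f a))"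
  unfolding lin_ext_def using assms
  by (intro sum.mono_neutral_left) (auto simp: in_keys_iff scale_simps)

lemma lin_lin_ext: "lin (lin_ext f)"
  unfolding lin_iff
proof (intro conjI allI)
  fix x y :: "'a \<Rightarrow>\<^sub>0 complex"
  let ?A = "Poly_Mapping.keys x \<union> Poly_Mapping.keys y"
  have "Poly_Mapping.keys (x + y) \<subseteq> ?A" by (rule Poly_Mapping.keys_add)
  then show "lin_ext f (x + y) = lin_ext f x + lin_ext f y"
    by (simp add: lin_ext_superset[of ?A] lookup_add scale_add_left sum.distrib)
next
  fix c and x :: "'a \<Rightarrow>\<^sub>0 complex"
  have "Poly_Mapping.keys (scale c x) \<subseteq> Poly_Mapping.keys x"
    by (auto simp: in_keys_iff)
  then show "lin_ext f (scale c x) = scale c (lin_ext f x)"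
    by (simp add: lin_ext_superset[of "Poly_Mapping.keys x"] scale_sum scale_simps)
qed

lemma lin_ext_bas [simp]: "lin_ext f (bas a) = f a"
  by (simp add: lin_ext_def scale_simps)

lemma bilin_ext_bas [simp]: "bilin_ext f (bas a) (bas b) = f a b"
  by (simp add: bilin_ext_def)

lemma lin_add: "lin f \<Longrightarrow> f (x + y) = f x + f y"
  and lin_scale: "lin f \<Longrightarrow> f (scale c x) = scale c (f x)"
  by (simp_all add: lin_iff)

lemma lin_0: "lin f \<Longrightarrow> f 0 = 0"
  using lin_scale[of f 0 0] by (simp add: scale_simps)

lemma lin_minus: "lin f \<Longrightarrow> f (- x) = - f x"
  using lin_scale[of f "- 1" x] by (simp add: scale_simps)

lemma lin_sum: "lin f \<Longrightarrow> f (sum g A) = (\<Sum>a\<in>A. f (g a))"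
  by (induction A rule: infinite_finite_induct) (auto simp: lin_0 lin_add)

lemma bas_expansion: "x = (\<Sum>b\<in>Poly_Mapping.keys x. scale (Poly_Mapping.lookup x b) (bas b))"
proof (rule poly_mapping_eqI)
  fix k
  show "Poly_Mapping.lookup x k =
    Poly_Mapping.lookup (\<Sum>b\<in>Poly_Mapping.keys x. scale (Poly_Mapping.lookup x b) (bas b)) k"
    by (simp add: lookup_sum lookup_single when_def if_distrib sum.delta in_keys_iff cong: if_cong)
qed

lemma lin_eq_on_bas:
  assumes "lin f" "lin g" "\<And>b. b \<in> Poly_Mapping.keys x \<Longrightarrow> f (bas b) = g (bas b)"
  shows "f x = g x"
proof -
  have *: "h x = (\<Sum>b\<in>Poly_Mapping.keys x. scale (Poly_Mapping.lookup x b) (h (bas b)))"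
    if "lin h" for h :: "('a \<Rightarrow>\<^sub>0 complex) \<Rightarrow> ('b \<Rightarrow>\<^sub>0 complex)"
    by (subst bas_expansion[of x]) (simp add: lin_sum[OF that] lin_scale[OF that])
  show ?thesis by (simp add: *[OF assms(1)] *[OF assms(2)] assms(3))
qed

lemma lin_bilin_ext: "lin (bilin_ext f x)" "lin (\<lambda>x. bilin_ext f x y)"
proof -
  show "lin (\<lambda>x. bilin_ext f x y)"
    unfolding bilin_ext_def by (rule lin_lin_ext)
  show "lin (bilin_ext f x)"
    unfolding lin_iff bilin_ext_def lin_ext_def[of _ x]
    by (simp add: lin_add[OF lin_lin_ext] lin_scale[OF lin_lin_ext] scale_simps scale_sum
        sum.distrib mult.commute)
qed

lemma homog_add: "x \<in> homog par i \<Longrightarrow> y \<in> homog par i \<Longrightarrow> x + y \<in> homog par i"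
  unfolding homog_def using Poly_Mapping.keys_add[of x y] by blast

lemma homog_scale: "x \<in> homog par i \<Longrightarrow> scale c x \<in> homog par i"
  by (auto simp: homog_def in_keys_iff)

lemma homog_sum: "(\<And>a. a \<in> A \<Longrightarrow> f a \<in> homog par i) \<Longrightarrow> sum f A \<in> homog par i"
proof (induction A rule: infinite_finite_induct)
  case (insert a A)
  then show ?case by (simp add: homog_add)
qed (auto simp: homog_def)

lemma homog_bas: "par b = i \<Longrightarrow> bas b \<in> homog par i"
  by (simp add: homog_def)

lemma homog_minus: "x \<in> homog par i \<Longrightarrow> - x \<in> homog par i"
  using homog_scale[of x par i "- 1"] by (simp add: scale_simps)

lemma homog_0: "0 \<in> homog par i"
  by (simp add: homog_def)

lemma n2_bracket_basis_homog: "n2_bracket_basis a b \<in> homog n2_par (n2_par a + n2_par b)"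
  by (cases a; cases b) (auto intro!: homog_add homog_scale homog_minus homog_bas homog_0)

lemma n2_bracket_basis_skew:
  "n2_bracket_basis a b = - scale (sgn2 (n2_par a * n2_par b)) (n2_bracket_basis b a)"
  by (cases a; cases b)
    (auto simp: sgn2_def scale_simps add_ac intro!: poly_mapping_eqI
      simp: lookup_add lookup_minus algebra_simps)

lemmas n2_br_lin = lin_bilin_ext[of n2_bracket_basis, folded n2_bracket_def]

lemma n2_bracket_simps:
  "n2_bracket x (y + z) = n2_bracket x y + n2_bracket x z"
  "n2_bracket (x + y) z = n2_bracket x z + n2_bracket y z"
  "n2_bracket x (scale c y) = scale c (n2_bracket x y)"
  "n2_bracket (scale c x) y = scale c (n2_bracket x y)"
  "n2_bracket x (- y) = - n2_bracket x y" "n2_bracket (- x) y = - n2_bracket x y"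
  "n2_bracket x 0 = 0" "n2_bracket 0 y = 0"
  "n2_bracket (bas a) (bas b) = n2_bracket_basis a b"
  using lin_add[OF n2_br_lin(1)] lin_add[OF n2_br_lin(2)] lin_scale[OF n2_br_lin(1)]
    lin_scale[OF n2_br_lin(2)] lin_minus[OF n2_br_lin(1)] lin_minus[OF n2_br_lin(2)]
    lin_0[OF n2_br_lin(1)] lin_0[OF n2_br_lin(2)]
  by (simp_all add: n2_bracket_def)

lemma n2_jacobi_basis:
  "n2_bracket (bas a) (n2_bracket (bas b) (bas c)) =
     n2_bracket (n2_bracket (bas a) (bas b)) (bas c)
     + scale (sgn2 (n2_par a * n2_par b)) (n2_bracket (bas b) (n2_bracket (bas a) (bas c)))"
  by (cases a; cases b; cases c)
    (auto simp: n2_bracket_simps sgn2_def intro!: poly_mapping_eqI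
      simp: lookup_add lookup_minus lookup_single when_def algebra_simps scale_simps
        add_divide_distrib diff_divide_distrib)

theorem lie_superalgebra_n2: "lie_superalgebra n2_par n2_bracket"
  unfolding lie_superalgebra_def
proof (intro conjI allI ballI)
  show "lin (n2_bracket x)" "lin (\<lambda>x. n2_bracket x y)" for x y
    by (rule n2_br_lin)+
next
  fix i j x y assume x: "x \<in> homog n2_par i" and y: "y \<in> homog n2_par j"
  show "n2_bracket x y \<in> homog n2_par (i + j)"
    unfolding n2_bracket_def bilin_ext_def lin_ext_def
    using x y n2_bracket_basis_homog
    by (intro homog_sum homog_scale) (auto simp: homog_def)
next
  fix i j x y assume x: "x \<in> homog n2_par i" and y: "y \<in> homog n2_par j"
  show "n2_bracket x y = - scale (sgn2 (i * j)) (n2_bracket y x)"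
  proof (rule lin_eq_on_bas[where x = x])
    fix a assume a: "a \<in> Poly_Mapping.keys x"
    show "n2_bracket (bas a) y = - scale (sgn2 (i * j)) (n2_bracket y (bas a))"
    proof (rule lin_eq_on_bas[where x = y])
      fix b assume "b \<in> Poly_Mapping.keys y"
      with a x y show "n2_bracket (bas a) (bas b) = - scale (sgn2 (i * j)) (n2_bracket (bas b) (bas a))"
        using n2_bracket_basis_skew[of a b] by (auto simp: homog_def n2_bracket_simps)
    qed (simp_all add: lin_iff n2_bracket_simps scale_simps mult.commute)
  qed (simp_all add: lin_iff n2_bracket_simps scale_simps mult.commute)
next
  fix i j x y z assume x: "x \<in> homog n2_par i" and y: "y \<in> homog n2_par j"
  let ?s = "sgn2 (i * j)"
  show "n2_bracket x (n2_bracket y z) =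
    n2_bracket (n2_bracket x y) z + scale ?s (n2_bracket y (n2_bracket x z))"
  proof (rule lin_eq_on_bas[where x = x])
    fix a assume a: "a \<in> Poly_Mapping.keys x"
    show "n2_bracket (bas a) (n2_bracket y z) =
      n2_bracket (n2_bracket (bas a) y) z + scale ?s (n2_bracket y (n2_bracket (bas a) z))"
    proof (rule lin_eq_on_bas[where x = y])
      fix b assume b: "b \<in> Poly_Mapping.keys y"
      show "n2_bracket (bas a) (n2_bracket (bas b) z) =
        n2_bracket (n2_bracket (bas a) (bas b)) z
        + scale ?s (n2_bracket (bas b) (n2_bracket (bas a) z))"
      proof (rule lin_eq_on_bas[where x = z])
        fix c
        show "n2_bracket (bas a) (n2_bracket (bas b) (bas c)) =
          n2_bracket (n2_bracket (bas a) (bas b)) (bas c)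
          + scale ?s (n2_bracket (bas b) (n2_bracket (bas a) (bas c)))"
          using n2_jacobi_basis[of a b c] a b x y by (auto simp: homog_def)
      qed (simp_all add: lin_iff n2_bracket_simps scale_simps mult.commute)
    qed (simp_all add: lin_iff n2_bracket_simps scale_simps mult.commute)
  qed (simp_all add: lin_iff n2_bracket_simps scale_simps mult.commute)
qed

end

theory Submission
  imports Defs
begin

text \<open>
A compatible cobracket \<open>\<Delta>\<close> is in particular an even derivation of the algebra \<open>L\<close> with values in the
super skew-symmetric tensors.  The theorem splits into two claims: every such derivation is inner,
\<open>\<Delta> x = x * r\<close>, and the co-Jacobi identity then forces \<open>c(r) = 0\<close>.

\<^bold>\<open>The derivation is inner.\<close>  A suitable inner derivation is subtracted four times, after which nothing
is left.  The element \<open>I\<^sub>0\<close> acts diagonalisably, its eigenvalues being the charges (\<open>+1\<close> on \<open>G\<^sup>+\<close>,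
\<open>-1\<close> on \<open>G\<^sup>-\<close>, \<open>0\<close> on \<open>L\<close> and \<open>I\<close>); as usual for a derivation, the part that does not preserve the
charge is inner (\<open>neutral_mod_inner\<close>).  A charge-preserving derivation is determined by a few families
of finitely supported arrays of coefficients \<open>f(i, j)\<close>, which are best read as Laurent polynomials
\<open>\<Sum> f(i, j) z\<^sup>i w\<^sup>j\<close>.  On such polynomials the \<open>I\<^sub>m\<close> act essentially by multiplication: on the
\<open>G\<^sup>+ \<otimes> G\<^sup>-\<close> part \<open>I\<^sub>m\<close> multiplies by \<open>z\<^sup>m - w\<^sup>m\<close>, on \<open>L \<otimes> G\<^sup>\<plusminus>\<close> and \<open>I \<otimes> G\<^sup>\<plusminus>\<close> by \<open>\<plusminus>w\<^sup>m\<close> up to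
a triangular term, and \<open>I\<^sub>m\<close> sends \<open>L\<close>-parts to \<open>I\<close>-parts.  Nearly every vanishing statement then
rests on the same fact: \<open>z - w\<close> is not a zero divisor (\<open>finite_support_shift_invariant\<close>).

The relations \<open>[I\<^sub>m, I\<^sub>n] = 0\<close> give \<open>e\<^sub>n = (z\<^sup>n - w\<^sup>n)/(z - w) e\<^sub>1\<close> for the \<open>G\<^sup>+ \<otimes> G\<^sup>-\<close> part \<open>e\<^sub>n\<close> of
\<open>\<Delta> I\<^sub>n\<close>, and the relations \<open>[L\<^sub>n, I\<^sub>1] = - I\<^sub>n\<^sub>+\<^sub>1\<close> for \<open>n = 0, -1\<close> show that \<open>z - w\<close> divides \<open>e\<^sub>1\<close>
(\<open>inner_modulo_GG_part\<close>).  Next, \<open>[I\<^sub>m, G\<^sup>+\<^sub>k]\<close> shows that the \<open>L \<otimes> I\<close> part of \<open>\<Delta> I\<^sub>m\<close> is additive in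
\<open>m\<close> after a shift, hence \<open>m w\<^sup>m \<beta>\<close>, and that the \<open>L \<otimes> G\<^sup>+\<close> part of \<open>\<Delta> G\<^sup>+\<^sub>k\<close> is \<open>w\<^sup>k (\<gamma> + k \<beta>)\<close>; both are
removed by one tensor with \<open>L \<otimes> L\<close> and \<open>L \<otimes> I\<close> parts (\<open>inner_modulo_L_parts\<close>).  What remains vanishes
on all \<open>I\<^sub>m\<close> and has only the \<open>I \<otimes> G\<^sup>\<plusminus>\<close> parts \<open>w\<^sup>k \<eta>\<close> and \<open>w\<^sup>k \<eta>'\<close> on \<open>G\<^sup>\<plusminus>\<^sub>k\<close>; because the bracket
\<open>[G\<^sup>+\<^sub>p, G\<^sup>-\<^sub>q]\<close> depends on \<open>p\<close> and \<open>q\<close> through \<open>p + q\<close> only, up to multiples of an \<open>I\<close>, it follows that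
\<open>\<eta>'(z, w) = \<eta>(w, z) = - \<eta>(z, w)\<close>, and such a pair comes from a tensor in \<open>I \<otimes> I\<close>
(\<open>normalised_derivation_inner\<close>).

\<^bold>\<open>The classical Yang-Baxter equation.\<close>  Let \<open>\<xi>\<close> be the super-cyclic map and let \<open>x\<close> act on the
first tensor factor only.  For skew-symmetric even \<open>r\<close>, the co-Jacobi expression of \<open>\<Delta>\<^sub>r\<close> at \<open>x\<close> is the
cyclic sum \<open>(1 + \<xi> + \<xi>\<^sup>2)((ad x \<otimes> 1 \<otimes> 1) c(r))\<close> (\<open>co_jacobi_sum_cybe\<close>).  If the index of \<open>x\<close> is
very large, then the three summands have disjoint supports: in the first one only the first tensor
factor has a large index, in the others it is another factor.  So \<open>(ad x \<otimes> 1 \<otimes> 1) c(r) = 0\<close> for all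
\<open>x\<close> of large index, and no nonzero element of \<open>L\<close> is annihilated by all of these
(\<open>cyclic_sum_ad_eq_0D\<close>).
\<close>

section \<open>Signs, tensors and coefficients\<close>

abbreviation n2_diag where "n2_diag \<equiv> diag_action n2_par n2_bracket"
abbreviation koszul :: "n2_basis \<Rightarrow> n2_basis \<Rightarrow> complex" where
  "koszul u v \<equiv> sgn2 (n2_par u * n2_par v)"

lemma sgn2_simps [simp]: "sgn2 0 = 1" "sgn2 1 = -1"
  by (simp_all add: sgn2_def)

lemma sgn2_add: "sgn2 (i + j) = sgn2 i * sgn2 j"
  by (cases i; cases j) simp_all

lemma sgn2_square: "sgn2 i * sgn2 i = 1"
  by (cases i) simp_all

lemma lookup_lin_ext:
  "Poly_Mapping.lookup (lin_ext f x) k =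
     (\<Sum>a\<in>Poly_Mapping.keys x. Poly_Mapping.lookup x a * Poly_Mapping.lookup (f a) k)"
  by (simp add: lin_ext_def lookup_sum)

lemma lin_ext_cong:
  "(\<And>a. a \<in> Poly_Mapping.keys x \<Longrightarrow> f a = g a) \<Longrightarrow> lin_ext f x = lin_ext g x"
  by (simp add: lin_ext_def)

lemma lookup_tensor [simp]:
  "Poly_Mapping.lookup (x \<otimes> y) (a, b) = Poly_Mapping.lookup x a * Poly_Mapping.lookup y b"
proof -
  have *: "Poly_Mapping.lookup (lin_ext (\<lambda>b'. bas (a', b')) y) (a, b) =
      (if a' = a then Poly_Mapping.lookup y b else 0)" for a'
    by (simp add: lookup_lin_ext lookup_single when_def if_distrib sum.delta' in_keys_iff cong: if_cong)
  show ?thesis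
    unfolding tensor_def bilin_ext_def
    by (subst lookup_lin_ext) (simp add: * if_distrib sum.delta' in_keys_iff cong: if_cong)
qed

section \<open>The adjoint action on coefficients\<close>

text \<open>
The transpose of \<open>ad x\<close>: \<open>coad x u f\<close> is the sum over all basis elements \<open>a\<close> of the coefficient of \<open>u\<close>
in \<open>[x, a]\<close> times \<open>f a\<close>.  At most two \<open>a\<close> contribute, so it makes sense for every function \<open>f\<close>, and
the value of \<open>ad x\<close> at any vector is read off coefficientwise; all relations between the coefficients
of a derivation are obtained by evaluating these equations.
\<close>

fun coad :: "n2_basis \<Rightarrow> n2_basis \<Rightarrow> (n2_basis \<Rightarrow> complex) \<Rightarrow> complex" where
  "coad (LL m) (LL k) f = of_int (2 * m - k) * f (LL (k - m))"
| "coad (LL m) (II k) f = - of_int (k - m) * f (II (k - m))"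
| "coad (LL m) (GP k) f = (of_int m / 2 - half_idx (k - m)) * f (GP (k - m))"
| "coad (LL m) (GM k) f = (of_int m / 2 - half_idx (k - m)) * f (GM (k - m))"
| "coad (II m) (LL k) f = 0"
| "coad (II m) (II k) f = of_int m * f (LL (k - m))"
| "coad (II m) (GP k) f = f (GP (k - m))"
| "coad (II m) (GM k) f = - f (GM (k - m))"
| "coad (GP k) (LL n) f = 2 * f (GM (n - k - 1))"
| "coad (GP k) (II n) f = of_int (2 * k + 1 - n) * f (GM (n - k - 1))"
| "coad (GP k) (GP j) f = - (of_int (j - k) / 2 - half_idx k) * f (LL (j - k)) - f (II (j - k))"
| "coad (GP k) (GM j) f = 0"
| "coad (GM l) (LL n) f = 2 * f (GP (n - l - 1))"
| "coad (GM l) (II n) f = of_int (n - 1 - 2 * l) * f (GP (n - l - 1))"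
| "coad (GM l) (GP j) f = 0"
| "coad (GM l) (GM j) f = - (of_int (j - l) / 2 - half_idx l) * f (LL (j - l)) + f (II (j - l))"

lemma coad_sum:
  "coad x u (\<lambda>a. \<Sum>i\<in>S. c i * g i a) = (\<Sum>i\<in>S. c i * coad x u (g i))"
  by (cases x; cases u)
    (simp_all add: sum_distrib_left sum_negf sum.distrib[symmetric] sum_subtractf[symmetric]
      algebra_simps)

lemma coad_bas: "coad x u (Poly_Mapping.lookup (bas a)) = Poly_Mapping.lookup (n2_bracket_basis x a) u"
  by (cases x; cases u; cases a)
    (auto simp: lookup_single when_def lookup_add lookup_minus algebra_simps)

lemma lookup_expansion:
  "Poly_Mapping.lookup y =
    (\<lambda>a. \<Sum>b\<in>Poly_Mapping.keys y. Poly_Mapping.lookup y b * Poly_Mapping.lookup (bas b) a)"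
proof
  fix a
  have "Poly_Mapping.lookup y a = Poly_Mapping.lookup
     (\<Sum>b\<in>Poly_Mapping.keys y. scale (Poly_Mapping.lookup y b) (bas b)) a"
    by (subst bas_expansion[of y]) (rule refl)
  then show "Poly_Mapping.lookup y a =
    (\<Sum>b\<in>Poly_Mapping.keys y. Poly_Mapping.lookup y b * Poly_Mapping.lookup (bas b) a)"
    by (simp add: lookup_sum)
qed

lemma lookup_n2_bracket:
  "Poly_Mapping.lookup (n2_bracket (bas x) y) u = coad x u (Poly_Mapping.lookup y)"
  by (subst (2) lookup_expansion)
    (simp add: coad_sum coad_bas n2_bracket_def bilin_ext_def lookup_lin_ext)

lemma lookup_n2_diag:
  "Poly_Mapping.lookup (n2_diag (bas x) t) (u, v) =
     coad x u (\<lambda>a. Poly_Mapping.lookup t (a, v)) +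
     koszul x u * coad x v (\<lambda>b. Poly_Mapping.lookup t (u, b))"
proof -
  let ?t = "Poly_Mapping.lookup t"
  have exp: "?t (a, b) = (\<Sum>p\<in>Poly_Mapping.keys t. ?t p *
     (Poly_Mapping.lookup (bas (fst p)) a * Poly_Mapping.lookup (bas (snd p)) b))" for a b
    by (subst lookup_expansion)
      (auto simp: lookup_single when_def intro!: sum.cong)
  have "coad x u (\<lambda>a. ?t (a, v)) = (\<Sum>p\<in>Poly_Mapping.keys t. (?t p * Poly_Mapping.lookup (bas (snd p)) v) *
      coad x u (Poly_Mapping.lookup (bas (fst p))))"
    by (subst exp, subst coad_sum[symmetric]) (simp add: mult_ac)
  moreover have "coad x v (\<lambda>b. ?t (u, b)) = (\<Sum>p\<in>Poly_Mapping.keys t. (?t p * Poly_Mapping.lookup (bas (fst p)) u) *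
      coad x v (Poly_Mapping.lookup (bas (snd p))))"
    by (subst exp, subst coad_sum[symmetric]) (simp add: mult_ac)
  moreover have "Poly_Mapping.lookup (n2_diag (bas x) t) (u, v) =
     (\<Sum>p\<in>Poly_Mapping.keys t. ?t p * (coad x u (Poly_Mapping.lookup (bas (fst p))) * Poly_Mapping.lookup (bas (snd p)) v
        + koszul x u * (Poly_Mapping.lookup (bas (fst p)) u * coad x v (Poly_Mapping.lookup (bas (snd p))))))"
    unfolding diag_action_def bilin_ext_def lin_ext_bas lookup_lin_ext
    by (intro sum.cong refl)
      (auto simp: lookup_add n2_bracket_simps coad_bas lookup_single when_def)
  ultimately show ?thesis
    by (simp add: sum.distrib sum_distrib_left algebra_simps)
qed

lemma coad_combination:
  "coad x u (\<lambda>a. c * f a + d * g a) = c * coad x u f + d * coad x u g"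
  by (cases x; cases u) (simp_all add: algebra_simps)

lemma coad_simps:
  "coad x u (\<lambda>a. f a + g a) = coad x u f + coad x u g"
  "coad x u (\<lambda>a. f a - g a) = coad x u f - coad x u g"
  "coad x u (\<lambda>a. - f a) = - coad x u f"
  "coad x u (\<lambda>a. c * f a) = c * coad x u f"
  "coad x u (\<lambda>a. f a * c) = coad x u f * c"
  "coad x u (\<lambda>a. 0) = 0"
  using coad_combination[of x u 1 f 1 g] coad_combination[of x u 1 f "- 1" g]
    coad_combination[of x u "- 1" f 0 g] coad_combination[of x u c f 0 g]
    coad_combination[of x u 0 f 0 g]
  by (simp_all add: mult.commute)

text \<open>
The bracket is graded, so only basis elements \<open>a\<close> of parity \<open>par u + par x\<close> contribute, and a factor
depending on the parity of \<open>a\<close> can be taken out.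
\<close>

lemma coad_parity:
  "coad x u (\<lambda>a. h (n2_par a) * f a) = h (n2_par u + n2_par x) * coad x u f"
  by (cases x; cases u) (simp_all add: algebra_simps)

lemma tensor_simps:
  "(x + x') \<otimes> y = x \<otimes> y + x' \<otimes> y" "x \<otimes> (y + y') = x \<otimes> y + x \<otimes> y'"
  "(x - x') \<otimes> y = x \<otimes> y - x' \<otimes> y" "x \<otimes> (y - y') = x \<otimes> y - x \<otimes> y'"
  "scale c x \<otimes> y = scale c (x \<otimes> y)" "x \<otimes> scale c y = scale c (x \<otimes> y)"
  "(- x) \<otimes> y = - (x \<otimes> y)" "x \<otimes> (- y) = - (x \<otimes> y)"
  "0 \<otimes> y = 0" "x \<otimes> 0 = 0"
  by (rule poly_mapping_eqI; clarsimp simp: lookup_add lookup_minus algebra_simps)+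

lemma tensor_bas: "bas a \<otimes> bas b = bas (a, b)"
  by (simp add: tensor_def)

lemma lin_n2_diag: "lin (n2_diag x)" "lin (\<lambda>x. n2_diag x t)"
  unfolding diag_action_def by (rule lin_bilin_ext)+

lemma lin_eqI:
  assumes "lin f" "lin g" "\<And>b. f (bas b) = g (bas b)"
  shows "f x = g x"
  using lin_eq_on_bas assms by blast

lemma n2_diag_bas_tensor:
  assumes "p \<in> homog n2_par i"
  shows "n2_diag (bas x) (p \<otimes> q) =
    n2_bracket (bas x) p \<otimes> q + scale (sgn2 (n2_par x * i)) (p \<otimes> n2_bracket (bas x) q)"
proof (rule poly_mapping_eqI)
  fix k :: "n2_basis \<times> n2_basis"
  obtain u v where k: "k = (u, v)" by (cases k)
  have "Poly_Mapping.lookup p u = 0" if "n2_par u \<noteq> i"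
    using that assms by (auto simp: homog_def in_keys_iff)
  then show "Poly_Mapping.lookup (n2_diag (bas x) (p \<otimes> q)) k = Poly_Mapping.lookup
    (n2_bracket (bas x) p \<otimes> q + scale (sgn2 (n2_par x * i)) (p \<otimes> n2_bracket (bas x) q)) k"
    unfolding k by (cases "n2_par u = i")
     (auto simp: lookup_n2_diag lookup_add lookup_n2_bracket coad_simps algebra_simps)
qed

lemma n2_diag_tensor:
  assumes "z \<in> homog n2_par j" "p \<in> homog n2_par i"
  shows "n2_diag z (p \<otimes> q) =
    n2_bracket z p \<otimes> q + scale (sgn2 (j * i)) (p \<otimes> n2_bracket z q)"
proof (rule lin_eq_on_bas[where x = z])
  fix b assume "b \<in> Poly_Mapping.keys z"
  with assms have "n2_par b = j" by (auto simp: homog_def)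
  then show "n2_diag (bas b) (p \<otimes> q) =
    n2_bracket (bas b) p \<otimes> q + scale (sgn2 (j * i)) (p \<otimes> n2_bracket (bas b) q)"
    using n2_diag_bas_tensor[OF assms(2)] by blast
qed (simp_all add: lin_iff n2_bracket_simps tensor_simps scale_simps lin_add[OF lin_n2_diag(2)]
      lin_scale[OF lin_n2_diag(2)] mult.commute)

text \<open>
The diagonal action is an action of the Lie superalgebra: the Jacobi identity in each of the two
factors, the mixed terms cancelling because of the signs.  It makes inner maps derivations.
\<close>

lemma n2_diag_bracket:
  "n2_diag (n2_bracket_basis x y) t =
     n2_diag (bas x) (n2_diag (bas y) t) - scale (koszul x y) (n2_diag (bas y) (n2_diag (bas x) t))"
proof (rule lin_eqI[where x = t], goal_cases)
  case 2
  then show ?case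
    by (simp add: lin_iff lin_add[OF lin_n2_diag(1)] lin_scale[OF lin_n2_diag(1)] scale_simps mult.commute)
next
  case (3 ab)
  obtain a b where ab: "ab = (a, b)" by (cases ab)
  have hom: "n2_bracket_basis u v \<in> homog n2_par (n2_par u + n2_par v)"  "bas u \<in> homog n2_par (n2_par u)" for u v
    by (rule n2_bracket_basis_homog, rule homog_bas, rule refl)
  have jac: "n2_bracket (n2_bracket_basis x y) (bas c) =
    n2_bracket (bas x) (n2_bracket_basis y c) - scale (koszul x y) (n2_bracket (bas y) (n2_bracket_basis x c))" for c
    using n2_jacobi_basis[of x y c] by (simp add: n2_bracket_simps)
  have bb: "n2_bracket (bas c) (bas d) = n2_bracket_basis c d" for c d by (simp add: n2_bracket_simps)
  note dt = n2_diag_tensor[OF hom(2) hom(2)] n2_diag_tensor[OF hom(2) hom(1)] n2_diag_tensor[OF hom(1) hom(2)]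
  show ?case
    unfolding ab tensor_bas[symmetric]
    by (simp add: dt bb lin_add[OF lin_n2_diag(1)] lin_scale[OF lin_n2_diag(1)] jac tensor_simps scale_simps
          distrib_left distrib_right sgn2_add)
       (cases "n2_par x"; cases "n2_par y"; cases "n2_par a"; simp add: scale_simps)
qed (rule lin_n2_diag)

section \<open>Skew-symmetric derivations\<close>

text \<open>
The even elements of \<open>Im (1 - \<tau>)\<close>: since \<open>\<tau>\<^sup>2 = 1\<close> and \<open>2\<close> is invertible, this image is the kernel of
\<open>1 + \<tau>\<close>.
\<close>

definition even_skew :: "(n2_basis \<times> n2_basis \<Rightarrow>\<^sub>0 complex) \<Rightarrow> bool" where
  "even_skew t \<longleftrightarrow>
     (\<forall>u v. Poly_Mapping.lookup t (v, u) = - koszul u v * Poly_Mapping.lookup t (u, v)) \<and>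
     (\<forall>u v. n2_par u \<noteq> n2_par v \<longrightarrow> Poly_Mapping.lookup t (u, v) = 0)"

text \<open>
These properties are inherited by a difference of two such maps and shared by the inner derivations of
even skew-symmetric tensors, so they persist when inner derivations are subtracted.
\<close>

definition skew_derivation ::
  "((n2_basis \<Rightarrow>\<^sub>0 complex) \<Rightarrow> (n2_basis \<times> n2_basis \<Rightarrow>\<^sub>0 complex)) \<Rightarrow> bool" where
  "skew_derivation D \<longleftrightarrow> lin D \<and>
     (\<forall>x u v. Poly_Mapping.lookup (D (bas x)) (v, u) = - koszul u v * Poly_Mapping.lookup (D (bas x)) (u, v)) \<and>
     (\<forall>x u v. n2_par u + n2_par v \<noteq> n2_par x \<longrightarrow> Poly_Mapping.lookup (D (bas x)) (u, v) = 0) \<and>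
     (\<forall>x y. D (n2_bracket_basis x y) =
        n2_diag (bas x) (D (bas y)) - scale (koszul x y) (n2_diag (bas y) (D (bas x))))"

lemma skew_derivation_inner:
  assumes "even_skew r"
  shows "skew_derivation (\<lambda>x. n2_diag x r)"
  unfolding skew_derivation_def
proof (intro conjI allI impI)
  show "lin (\<lambda>x. n2_diag x r)" by (rule lin_n2_diag)
next
  fix x u v
  let ?r = "Poly_Mapping.lookup r"
  have sk: "?r (v, u) = - koszul u v * ?r (u, v)" for u v
    using assms unfolding even_skew_def by blast
  have A: "coad x v (\<lambda>a. ?r (a, u)) = - sgn2 ((n2_par v + n2_par x) * n2_par u) * coad x v (\<lambda>a. ?r (u, a))" for u v
  proof -
    have "(\<lambda>a. ?r (a, u)) = (\<lambda>a. - sgn2 (n2_par a * n2_par u) * ?r (u, a))"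
      by (rule ext, subst mult.commute[of "n2_par _"]) (rule sk)
    from arg_cong[OF this, of "coad x v"] show ?thesis
      unfolding coad_parity[of x v "\<lambda>p. - sgn2 (p * n2_par u)"] .
  qed
  show "Poly_Mapping.lookup (n2_diag (bas x) r) (v, u) = - koszul u v * Poly_Mapping.lookup (n2_diag (bas x) r) (u, v)"
    unfolding lookup_n2_diag
    unfolding A[of v u] A[of u v]
    by (cases "n2_par x"; cases "n2_par u"; cases "n2_par v"; simp)
next
  fix x u v assume *: "n2_par u + n2_par v \<noteq> n2_par x"
  let ?r = "Poly_Mapping.lookup r"
  have ev: "?r (u, v) = (if n2_par u = n2_par v then 1 else 0) * ?r (u, v)" for u v
  proof -
    have "n2_par u \<noteq> n2_par v \<longrightarrow> ?r (u, v) = 0"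
      using assms unfolding even_skew_def by blast
    then show ?thesis by simp
  qed
  have "coad x v (\<lambda>a. ?r (u, a)) = 0" if "n2_par u \<noteq> n2_par v + n2_par x"
  proof -
    have "(\<lambda>a. ?r (u, a)) = (\<lambda>a. (if n2_par u = n2_par a then 1 else 0) * ?r (u, a))"
      by (rule ext) (rule ev)
    from arg_cong[OF this, of "coad x v"] that show ?thesis
      unfolding coad_parity[of x v "\<lambda>p. if n2_par u = p then 1 else 0"] by simp
  qed
  moreover have "coad x u (\<lambda>a. ?r (a, v)) = 0" if "n2_par u + n2_par x \<noteq> n2_par v"
  proof -
    have "(\<lambda>a. ?r (a, v)) = (\<lambda>a. (if n2_par a = n2_par v then 1 else 0) * ?r (a, v))"
      by (rule ext) (rule ev)
    from arg_cong[OF this, of "coad x u"] that show ?thesis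
      unfolding coad_parity[of x u "\<lambda>p. if p = n2_par v then 1 else 0"] by simp
  qed
  moreover have "n2_par u \<noteq> n2_par v + n2_par x" "n2_par u + n2_par x \<noteq> n2_par v"
    using * by (cases "n2_par x"; cases "n2_par u"; cases "n2_par v"; simp; fail)
      (use * in \<open>cases "n2_par x"; cases "n2_par u"; cases "n2_par v"; simp\<close>)
  ultimately show "Poly_Mapping.lookup (n2_diag (bas x) r) (u, v) = 0"
    unfolding lookup_n2_diag by simp
next
  fix x y
  show "n2_diag (n2_bracket_basis x y) r =
      n2_diag (bas x) (n2_diag (bas y) r) - scale (koszul x y) (n2_diag (bas y) (n2_diag (bas x) r))"
    by (rule n2_diag_bracket)
qed

lemma skew_derivation_diff:
  assumes "skew_derivation D" "skew_derivation E"
  shows "skew_derivation (\<lambda>x. D x - E x)"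
proof -
  have l: "n2_diag x (y - z) = n2_diag x y - n2_diag x z" for x y z
    using lin_add[OF lin_n2_diag(1), of x y "- z"] lin_minus[OF lin_n2_diag(1), of x z] by simp
  have lin: "lin F" and br: "F (n2_bracket_basis x y) =
      n2_diag (bas x) (F (bas y)) - scale (koszul x y) (n2_diag (bas y) (F (bas x)))"
    if "skew_derivation F" for F x y
    using that unfolding skew_derivation_def by blast+
  have sk: "\<forall>x u v. Poly_Mapping.lookup (F (bas x)) (v, u) = - koszul u v * Poly_Mapping.lookup (F (bas x)) (u, v)"
    if "skew_derivation F" for F
    using that unfolding skew_derivation_def by blast
  have "Poly_Mapping.lookup (D (bas x) - E (bas x)) (v, u) =
      - koszul u v * Poly_Mapping.lookup (D (bas x) - E (bas x)) (u, v)" for x u v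
    using sk[OF assms(1), rule_format, of x v u] sk[OF assms(2), rule_format, of x v u]
    by (simp add: lookup_minus right_diff_distrib)
  note sk' = this
  have ev: "\<forall>x u v. n2_par u + n2_par v \<noteq> n2_par x \<longrightarrow> Poly_Mapping.lookup (F (bas x)) (u, v) = 0"
    if "skew_derivation F" for F
    using that unfolding skew_derivation_def by blast
  show ?thesis
    unfolding skew_derivation_def
  proof (intro conjI allI impI)
    show "lin (\<lambda>x. D x - E x)"
      using lin[OF assms(1)] lin[OF assms(2)] unfolding lin_iff by (simp add: scale_simps)
    fix x y u v
    show "D (n2_bracket_basis x y) - E (n2_bracket_basis x y) =
        n2_diag (bas x) (D (bas y) - E (bas y)) -
        scale (koszul x y) (n2_diag (bas y) (D (bas x) - E (bas x)))"
      using br[OF assms(1), of x y] br[OF assms(2), of x y] by (simp add: l scale_simps)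
    assume "n2_par u + n2_par v \<noteq> n2_par x"
    then show "Poly_Mapping.lookup (D (bas x) - E (bas x)) (u, v) = 0"
      using ev[OF assms(1)] ev[OF assms(2)] by (simp add: lookup_minus)
  qed (rule sk')
qed

lemma lookup_super_twist:
  "Poly_Mapping.lookup (super_twist n2_par t) (v, u) = koszul u v * Poly_Mapping.lookup t (u, v)"
proof -
  have "Poly_Mapping.lookup (super_twist n2_par t) (v, u) =
    (\<Sum>p\<in>Poly_Mapping.keys t. if p = (u, v) then koszul u v * Poly_Mapping.lookup t (u, v) else 0)"
    unfolding super_twist_def lookup_lin_ext
    by (intro sum.cong refl) (auto simp: lookup_single when_def split: if_splits)
  then show ?thesis by (simp add: in_keys_iff)
qed

lemma even_skew_in_im_one_minus_twist:
  assumes "even_skew r"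
  shows "r \<in> im_one_minus_twist n2_par"
proof -
  have "r = scale (1 / 2) r - super_twist n2_par (scale (1 / 2) r)"
  proof (rule poly_mapping_eqI)
    fix k :: "n2_basis \<times> n2_basis"
    obtain v u where k: "k = (v, u)" by (cases k)
    have "Poly_Mapping.lookup r (v, u) = - koszul u v * Poly_Mapping.lookup r (u, v)"
      using assms unfolding even_skew_def by blast
    then show "Poly_Mapping.lookup r k =
        Poly_Mapping.lookup (scale (1 / 2) r - super_twist n2_par (scale (1 / 2) r)) k"
      by (simp add: k lookup_minus lookup_super_twist)
  qed
  then show ?thesis unfolding im_one_minus_twist_def by (rule range_eqI)
qed

text \<open>
The sign in the definition of \<open>\<Delta>\<^sub>r\<close> involves the parity of \<open>r\<close> and disappears for even \<open>r\<close>.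
\<close>

lemma cobracket_of_even:
  assumes "even_skew r"
  shows "cobracket_of n2_par n2_bracket r = (\<lambda>x. n2_diag x r)"
proof
  fix x
  show "cobracket_of n2_par n2_bracket r x = n2_diag x r"
  proof (rule lin_eqI[where x = x])
    show "lin (cobracket_of n2_par n2_bracket r)" unfolding cobracket_of_def by (rule lin_bilin_ext)
    show "lin (\<lambda>x. n2_diag x r)" by (rule lin_n2_diag)
    fix b
    have par: "n2_par u = n2_par v" if "(u, v) \<in> Poly_Mapping.keys r" for u v
      using assms that unfolding even_skew_def in_keys_iff by blast
    have "cobracket_of n2_par n2_bracket r (bas b) = lin_ext (\<lambda>p. n2_diag (bas b) (bas p)) r"
      unfolding cobracket_of_def bilin_ext_def
      by (rule lin_ext_cong) (auto simp: par scale_simps)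
    also have "\<dots> = n2_diag (bas b) r"
      by (rule lin_eqI[OF lin_lin_ext lin_n2_diag(1)]) simp
    finally show "cobracket_of n2_par n2_bracket r (bas b) = n2_diag (bas b) r" .
  qed
qed

text \<open>
The twist axiom gives skew-symmetry because \<open>\<tau>\<^sup>2 = 1\<close>.  For the parity, the tensors all of whose
coefficients have a given parity form a subspace, which contains the span in the grading axiom.
\<close>

lemma superbialgebra_skew_derivation:
  assumes "lie_superbialgebra n2_par n2_bracket \<Delta>"
  shows "skew_derivation \<Delta>"
  unfolding skew_derivation_def
proof (intro conjI allI impI)
  interpret V: vector_space "scale :: complex \<Rightarrow> (n2_basis \<times> n2_basis \<Rightarrow>\<^sub>0 complex) \<Rightarrow> _"
    by (rule vector_space_scale)
  show "lin \<Delta>"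
    using assms unfolding lie_superbialgebra_def by blast
  fix x y u v
  have "\<Delta> (bas x) \<in> im_one_minus_twist n2_par"
    using assms unfolding lie_superbialgebra_def by blast
  then obtain t where t: "\<Delta> (bas x) = t - super_twist n2_par t"
    unfolding im_one_minus_twist_def by blast
  show "Poly_Mapping.lookup (\<Delta> (bas x)) (v, u) = - koszul u v * Poly_Mapping.lookup (\<Delta> (bas x)) (u, v)"
    unfolding t using sgn2_square[of "n2_par u * n2_par v"]
    by (simp add: lookup_minus lookup_super_twist right_diff_distrib mult.commute[of "n2_par v"]
       mult.assoc[symmetric])
  have "\<Delta> (n2_bracket (bas x) (bas y)) = n2_diag (bas x) (\<Delta> (bas y)) - scale (koszul x y) (n2_diag (bas y) (\<Delta> (bas x)))"
    using assms homog_bas[of n2_par x, OF refl] homog_bas[of n2_par y, OF refl]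
    unfolding lie_superbialgebra_def by blast
  then show "\<Delta> (n2_bracket_basis x y) = n2_diag (bas x) (\<Delta> (bas y)) - scale (koszul x y) (n2_diag (bas y) (\<Delta> (bas x)))"
    by (simp add: n2_bracket_simps)
  assume par: "n2_par u + n2_par v \<noteq> n2_par x"
  let ?G = "\<Union>j. {p \<otimes> q | p q. p \<in> homog n2_par j \<and> q \<in> homog n2_par (n2_par x - j)}"
  let ?S = "{t. \<forall>u v. n2_par u + n2_par v \<noteq> n2_par x \<longrightarrow> Poly_Mapping.lookup t (u, v) = 0}"
  have "?G \<subseteq> ?S"
  proof (intro subsetI CollectI allI impI)
    fix t u v
    assume "t \<in> ?G" and uv: "n2_par u + n2_par v \<noteq> n2_par x"
    then obtain j p q where t: "t = p \<otimes> q" and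
      hom: "p \<in> homog n2_par j" "q \<in> homog n2_par (n2_par x - j)"
      by blast
    have "u \<notin> Poly_Mapping.keys p \<or> v \<notin> Poly_Mapping.keys q"
    proof (rule ccontr)
      assume "\<not> ?thesis"
      with hom have "n2_par u = j" "n2_par v = n2_par x - j"
        unfolding homog_def by blast+
      then have "n2_par u + n2_par v = n2_par x" by (simp only: add_diff_eq add_diff_cancel_left')
      with uv show False ..
    qed
    then show "Poly_Mapping.lookup t (u, v) = 0"
      unfolding t by (auto simp: in_keys_iff)
  qed
  moreover have "V.subspace ?S"
    by (auto simp: V.subspace_def lookup_add)
  ultimately have "V.span ?G \<subseteq> ?S"
    by (rule V.span_minimal)
  moreover have "\<Delta> (bas x) \<in> V.span ?G"
    using assms homog_bas[of n2_par x, OF refl] unfolding lie_superbialgebra_def by blast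
  ultimately show "Poly_Mapping.lookup (\<Delta> (bas x)) (u, v) = 0"
    using par by blast
qed

lemma even_skewD:
  assumes "even_skew r"
  shows "Poly_Mapping.lookup r (v, u) = - koszul u v * Poly_Mapping.lookup r (u, v)"
    "n2_par u \<noteq> n2_par v \<Longrightarrow> Poly_Mapping.lookup r (u, v) = 0"
  using assms unfolding even_skew_def by blast+

lemma skew_derivationD:
  assumes "skew_derivation D"
  shows "lin D"
    "Poly_Mapping.lookup (D (bas x)) (v, u) = - koszul u v * Poly_Mapping.lookup (D (bas x)) (u, v)"
    "n2_par u + n2_par v \<noteq> n2_par x \<Longrightarrow> Poly_Mapping.lookup (D (bas x)) (u, v) = 0"
    "D (n2_bracket_basis x y) =
       n2_diag (bas x) (D (bas y)) - scale (koszul x y) (n2_diag (bas y) (D (bas x)))"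
  using assms unfolding skew_derivation_def by blast+

section \<open>Finitely supported arrays\<close>

definition finite_support :: "(int \<Rightarrow> int \<Rightarrow> complex) \<Rightarrow> bool" where
  "finite_support f \<longleftrightarrow> finite {(i, j). f i j \<noteq> 0}"

lemma finite_support_combination:
  assumes "finite_support f" "finite_support g"
  shows "finite_support (\<lambda>i j. c i j * f (i + a) (j + b) + d i j * g (i + a') (j + b'))"
proof -
  let ?F = "(\<lambda>(i, j). (i - a, j - b)) ` {(i, j). f i j \<noteq> 0}"
  let ?G = "(\<lambda>(i, j). (i - a', j - b')) ` {(i, j). g i j \<noteq> 0}"
  have "(i, j) \<in> ?F" if "f (i + a) (j + b) \<noteq> 0" for i j
    using that by (intro image_eqI[where x = "(i + a, j + b)"]) auto
  moreover have "(i, j) \<in> ?G" if "g (i + a') (j + b') \<noteq> 0" for i j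
    using that by (intro image_eqI[where x = "(i + a', j + b')"]) auto
  moreover have "f (i + a) (j + b) \<noteq> 0 \<or> g (i + a') (j + b') \<noteq> 0"
    if "c i j * f (i + a) (j + b) + d i j * g (i + a') (j + b') \<noteq> 0" for i j
    using that by auto
  ultimately have "{(i, j). c i j * f (i + a) (j + b) + d i j * g (i + a') (j + b') \<noteq> 0} \<subseteq> ?F \<union> ?G"
    by blast
  then show ?thesis
    using assms finite_subset unfolding finite_support_def by blast
qed

lemma finite_support_swap:
  assumes "finite_support f"
  shows "finite_support (\<lambda>i j. f j i)"
proof -
  have "{(i, j). f j i \<noteq> 0} = prod.swap ` {(i, j). f i j \<noteq> 0}"
    by (auto simp: image_iff)
  then show ?thesis
    using assms unfolding finite_support_def by simp
qed

lemma finite_support_lookup: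
  assumes "inj A" "inj B"
  shows "finite_support (\<lambda>i j. Poly_Mapping.lookup t (A i, B j))"
proof -
  have "{(i, j). Poly_Mapping.lookup t (A i, B j) \<noteq> 0} = map_prod A B -` Poly_Mapping.keys t"
    by (auto simp: in_keys_iff)
  moreover have "finite (map_prod A B -` Poly_Mapping.keys t)"
    using assms by (intro finite_vimageI finite_keys) (rule prod.inj_map)
  ultimately show ?thesis
    unfolding finite_support_def by simp
qed

lemma inj_n2_basis: "inj LL" "inj II" "inj GP" "inj GM"
  by (auto simp: inj_def)

text \<open>
For the Laurent polynomial \<open>p = \<Sum> f(i, j) z\<^sup>i w\<^sup>j\<close> the hypothesis says \<open>w p = z p\<close>, so this is the fact
that \<open>z - w\<close> is not a zero divisor.  A nonzero \<open>f\<close> would be constant along an infinite antidiagonal.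
\<close>

lemma finite_support_shift_invariant:
  assumes f: "finite_support f" and inv: "\<And>i j. f i j = f (i - 1) (j + 1)"
  shows "f i j = 0"
proof (rule ccontr)
  assume *: "f i j \<noteq> 0"
  have "f (i - int n) (j + int n) = f i j" for n
    by (induction n) (simp, metis inv add.assoc diff_diff_eq of_nat_Suc add.commute)
  then have "(\<lambda>n. (i - int n, j + int n)) ` UNIV \<subseteq> {(i, j). f i j \<noteq> 0}"
    using * by auto
  moreover have "inj (\<lambda>n. (i - int n, j + int n))"
    by (auto simp: inj_def)
  ultimately show False
    using f finite_subset finite_imageD infinite_UNIV_nat unfolding finite_support_def by blast
qed

text \<open>
The coefficients of the skew-symmetric tensors of charge \<open>0\<close> in terms of their parts in \<open>L \<otimes> L\<close>,
\<open>L \<otimes> I\<close>, \<open>I \<otimes> I\<close> and \<open>G\<^sup>+ \<otimes> G\<^sup>-\<close>.  There is no sign in front of \<open>\<epsilon>\<close> in \<open>G\<^sup>- \<otimes> G\<^sup>+\<close> because both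
factors are odd.
\<close>

fun neutral_tensor ::
  "(int \<Rightarrow> int \<Rightarrow> complex) \<Rightarrow> (int \<Rightarrow> int \<Rightarrow> complex) \<Rightarrow> (int \<Rightarrow> int \<Rightarrow> complex) \<Rightarrow> (int \<Rightarrow> int \<Rightarrow> complex) \<Rightarrow>
     n2_basis \<times> n2_basis \<Rightarrow> complex" where
  "neutral_tensor \<alpha> \<beta> \<delta> \<epsilon> (LL i, LL j) = \<alpha> i j"
| "neutral_tensor \<alpha> \<beta> \<delta> \<epsilon> (LL i, II j) = \<beta> i j"
| "neutral_tensor \<alpha> \<beta> \<delta> \<epsilon> (II j, LL i) = - \<beta> i j"
| "neutral_tensor \<alpha> \<beta> \<delta> \<epsilon> (II i, II j) = \<delta> i j"
| "neutral_tensor \<alpha> \<beta> \<delta> \<epsilon> (GP k, GM l) = \<epsilon> k l"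
| "neutral_tensor \<alpha> \<beta> \<delta> \<epsilon> (GM l, GP k) = \<epsilon> k l"
| "neutral_tensor \<alpha> \<beta> \<delta> \<epsilon> _ = 0"

lemma ex_neutral_tensor:
  assumes "finite_support \<alpha>" "finite_support \<beta>" "finite_support \<delta>" "finite_support \<epsilon>"
    and "\<And>i j. \<alpha> j i = - \<alpha> i j" "\<And>i j. \<delta> j i = - \<delta> i j"
  obtains r where "even_skew r" "Poly_Mapping.lookup r = neutral_tensor \<alpha> \<beta> \<delta> \<epsilon>"
proof
  let ?f = "neutral_tensor \<alpha> \<beta> \<delta> \<epsilon>"
  let ?supp = "\<lambda>f. {(i, j). f i j \<noteq> (0 :: complex)}"
  have "p \<in> map_prod LL LL ` ?supp \<alpha> \<union> map_prod LL II ` ?supp \<beta> \<union>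
      (prod.swap \<circ> map_prod LL II) ` ?supp \<beta> \<union> map_prod II II ` ?supp \<delta> \<union>
      map_prod GP GM ` ?supp \<epsilon> \<union> (prod.swap \<circ> map_prod GP GM) ` ?supp \<epsilon>" (is "_ \<in> ?S")
    if "?f p \<noteq> 0" for p
    using that by (cases "(\<alpha>, \<beta>, \<delta>, \<epsilon>, p)" rule: neutral_tensor.cases) (auto simp: image_iff)
  then have "{p. ?f p \<noteq> 0} \<subseteq> ?S" by blast
  moreover have "finite ?S"
    using assms unfolding finite_support_def by (intro finite_UnI finite_imageI)
  ultimately have "finite {p. ?f p \<noteq> 0}"
    by (rule finite_subset)
  then show *: "Poly_Mapping.lookup (Abs_poly_mapping ?f) = ?f"
    by (rule lookup_Abs_poly_mapping)
  show "even_skew (Abs_poly_mapping ?f)"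
    unfolding even_skew_def *
  proof (intro conjI allI impI)
    fix u v
    show "?f (v, u) = - koszul u v * ?f (u, v)"
      by (cases u; cases v; simp; rule assms)
    assume "n2_par u \<noteq> n2_par v"
    then show "?f (u, v) = 0" by (cases u; cases v) simp_all
  qed
qed

text \<open>
Used for sequences \<open>B\<close> that are seen to be additive because \<open>B m = F (m + k) - F k\<close> for all \<open>k\<close>.
\<close>

lemma int_additive_linear:
  fixes B :: "int \<Rightarrow> complex"
  assumes "\<And>m n. B (m + n) = B m + B n"
  shows "B m = of_int m * B 1"
proof (induction m rule: int_induct[where k = 0])
  case base
  show ?case using assms[of 0 0] by simp
next
  case (step1 i)
  then show ?case using assms[of i 1] by (simp add: algebra_simps)
next
  case (step2 i)
  then show ?case using assms[of "i - 1" 1] by (simp add: algebra_simps)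
qed

section \<open>Charges\<close>

fun charge :: "n2_basis \<Rightarrow> int" where
  "charge (LL m) = 0"
| "charge (II m) = 0"
| "charge (GP k) = 1"
| "charge (GM k) = - 1"

lemma coad_charge:
  "coad x u (\<lambda>a. h (charge a) * f a) = h (charge u - charge x) * coad x u f"
  by (cases x; cases u) (simp_all add: algebra_simps)

lemma coad_eq_0_by_charge:
  assumes "\<And>a. charge a = charge u - charge x \<Longrightarrow> f a = 0"
  shows "coad x u f = 0"
proof -
  have "f = (\<lambda>a. (if charge a = charge u - charge x then 0 else 1) * f a)"
    using assms by auto
  from arg_cong[OF this, of "coad x u"] show ?thesis
    unfolding coad_charge[of x u "\<lambda>p. if p = charge u - charge x then 0 else 1"] by simp
qed

lemma coad_II_0: "coad (II 0) u f = of_int (charge u) * f u"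
  by (cases u) simp_all

definition neutral :: "((n2_basis \<Rightarrow>\<^sub>0 complex) \<Rightarrow> (n2_basis \<times> n2_basis \<Rightarrow>\<^sub>0 complex)) \<Rightarrow> bool" where
  "neutral D \<longleftrightarrow> (\<forall>x u v. charge u + charge v \<noteq> charge x \<longrightarrow> Poly_Mapping.lookup (D (bas x)) (u, v) = 0)"

text \<open>
The source of every relation used below: the derivation rule for a bracket of two basis elements, at
one coefficient.
\<close>

lemma skew_derivation_cocycle:
  assumes "skew_derivation D"
  shows "Poly_Mapping.lookup (D (n2_bracket_basis x y)) (u, v) =
    (coad x u (\<lambda>a. Poly_Mapping.lookup (D (bas y)) (a, v)) +
      koszul x u * coad x v (\<lambda>b. Poly_Mapping.lookup (D (bas y)) (u, b))) -
    koszul x y * (coad y u (\<lambda>a. Poly_Mapping.lookup (D (bas x)) (a, v)) +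
      koszul y u * coad y v (\<lambda>b. Poly_Mapping.lookup (D (bas x)) (u, b)))"
  by (simp add: skew_derivationD(4)[OF assms] lookup_minus lookup_n2_diag)

lemma bracket_II_0: "n2_bracket_basis (II 0) x = scale (of_int (charge x)) (bas x)"
  by (cases x) (simp_all add: scale_simps)

text \<open>
The standard argument for a diagonalisable element.  On a tensor of charge \<open>c \<noteq> 0\<close> the element \<open>I\<^sub>0\<close>
is invertible, so an inner derivation removes the charged part of \<open>D I\<^sub>0\<close>.  Afterwards
\<open>[I\<^sub>0, x] = charge x \<cdot> x\<close> gives \<open>(I\<^sub>0 - charge x) (D x) = x * D I\<^sub>0\<close>, whose right-hand side has the
charge of \<open>x\<close>, so the components of \<open>D x\<close> of all other charges vanish.
\<close>

lemma neutral_mod_inner: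
  assumes D: "skew_derivation D"
  obtains r where "even_skew r" "neutral (\<lambda>x. D x - n2_diag x r)"
proof
  let ?t = "Poly_Mapping.lookup (D (bas (II 0)))"
  define f where "f = (\<lambda>(u, v). if charge u + charge v = 0 then 0 else ?t (u, v) / of_int (charge u + charge v))"
  define r where "r = Abs_poly_mapping f"
  have "{p. f p \<noteq> 0} \<subseteq> Poly_Mapping.keys (D (bas (II 0)))"
    by (auto simp: f_def in_keys_iff split: if_splits)
  then have r: "Poly_Mapping.lookup r = f"
    unfolding r_def using finite_subset[OF _ finite_keys] by (intro lookup_Abs_poly_mapping) blast
  show ev: "even_skew r"
    unfolding even_skew_def r
  proof (intro conjI allI impI)
    fix u v
    show "f (v, u) = - koszul u v * f (u, v)"
      unfolding f_def prod.case by (subst skew_derivationD(2)[OF D]) (simp add: add.commute)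
    assume "n2_par u \<noteq> n2_par v"
    then have "n2_par u + n2_par v \<noteq> n2_par (II 0)" by (cases "n2_par u"; cases "n2_par v"; simp)
    from skew_derivationD(3)[OF D this] show "f (u, v) = 0" by (simp add: f_def)
  qed
  define E where "E = (\<lambda>x. D x - n2_diag x r)"
  have E: "skew_derivation E"
    unfolding E_def by (intro skew_derivation_diff D skew_derivation_inner ev)
  have E0: "Poly_Mapping.lookup (E (bas (II 0))) (u, v) = 0" if "charge u + charge v \<noteq> 0" for u v
  proof -
    have "(of_int (charge u) :: complex) + of_int (charge v) \<noteq> 0"
      using that by (metis of_int_add of_int_eq_0_iff)
    then have "of_int (charge u) * f (u, v) + of_int (charge v) * f (u, v) = ?t (u, v)"
      using that by (simp add: f_def add_divide_distrib[symmetric] distrib_right[symmetric])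
    then show ?thesis
      unfolding E_def by (simp add: lookup_minus lookup_n2_diag coad_II_0 r)
  qed
  show "neutral E"
    unfolding neutral_def
  proof (intro allI impI)
    fix x u v assume *: "charge u + charge v \<noteq> charge x"
    have "coad x u (\<lambda>a. Poly_Mapping.lookup (E (bas (II 0))) (a, v)) = 0"
      "coad x v (\<lambda>b. Poly_Mapping.lookup (E (bas (II 0))) (u, b)) = 0"
      using * by (auto intro!: coad_eq_0_by_charge E0)
    with skew_derivation_cocycle[OF E, of "II 0" x u v]
    have "(of_int (charge u + charge v - charge x) :: complex) * Poly_Mapping.lookup (E (bas x)) (u, v) = 0"
      by (simp add: bracket_II_0 lin_scale[OF skew_derivationD(1)[OF E]] coad_II_0 algebra_simps)
    with * show "Poly_Mapping.lookup (E (bas x)) (u, v) = 0"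
      by (simp del: of_int_add of_int_diff)
  qed
qed

lemma neutral_inner:
  assumes "\<And>u v. charge u + charge v \<noteq> 0 \<Longrightarrow> Poly_Mapping.lookup r (u, v) = 0"
  shows "neutral (\<lambda>x. n2_diag x r)"
  unfolding neutral_def lookup_n2_diag
proof (intro allI impI)
  fix x u v assume *: "charge u + charge v \<noteq> charge x"
  have "coad x u (\<lambda>a. Poly_Mapping.lookup r (a, v)) = 0" "coad x v (\<lambda>b. Poly_Mapping.lookup r (u, b)) = 0"
    using * by (auto intro!: coad_eq_0_by_charge assms)
  then show "coad x u (\<lambda>a. Poly_Mapping.lookup r (a, v)) +
      koszul x u * coad x v (\<lambda>b. Poly_Mapping.lookup r (u, b)) = 0" by simp
qed

lemma neutral_tensor_charge: "charge u + charge v \<noteq> 0 \<Longrightarrow> neutral_tensor \<alpha> \<beta> \<delta> \<epsilon> (u, v) = 0"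
  by (cases u; cases v) simp_all

lemma neutral_diff: "neutral D \<Longrightarrow> neutral E \<Longrightarrow> neutral (\<lambda>x. D x - E x)"
  by (simp add: neutral_def lookup_minus)

definition neutral_derivation where
  "neutral_derivation D \<longleftrightarrow> skew_derivation D \<and> neutral D"

lemma neutral_derivation_diff_inner:
  assumes "neutral_derivation D" "even_skew r" "Poly_Mapping.lookup r = neutral_tensor \<alpha> \<beta> \<delta> \<epsilon>"
  shows "neutral_derivation (\<lambda>x. D x - n2_diag x r)"
proof -
  have "neutral (\<lambda>x. n2_diag x r)"
    by (rule neutral_inner) (simp add: assms(3) neutral_tensor_charge)
  then show ?thesis
    using assms unfolding neutral_derivation_def
    by (simp add: skew_derivation_diff skew_derivation_inner neutral_diff)
qed

lemma finite_support_pointwise: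
  assumes "finite_support f" "finite_support g"
  shows "finite_support (\<lambda>i j. c i j * f i j + d i j * g i j)"
  using finite_support_combination[OF assms, of c 0 0 d 0 0] by simp

lemma finite_support_0: "finite_support (\<lambda>i j. 0)"
  by (simp add: finite_support_def)

section \<open>Charge-preserving derivations are inner\<close>

text \<open>
Let \<open>e\<^sub>m\<close> and \<open>d\<^sub>n\<close> be the \<open>G\<^sup>+ \<otimes> G\<^sup>-\<close> parts of \<open>D I\<^sub>m\<close> and \<open>D L\<^sub>n\<close>.  A tensor \<open>u\<close> with
\<open>e\<^sub>m = (z\<^sup>m - w\<^sup>m) u\<close> for all \<open>m\<close> is wanted; the case \<open>m = 1\<close> suffices, since
\<open>(z - w) e\<^sub>m = (z\<^sup>m - w\<^sup>m) e\<^sub>1\<close>.  Modulo \<open>z - w\<close>, the relation for \<open>[L\<^sub>n, I\<^sub>1]\<close> becomes a differential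
equation for \<open>e\<^sub>1\<close>.  With \<open>\<theta>\<close> the Euler operator, \<open>n = 0\<close> says that \<open>z - w\<close> divides \<open>(\<theta> - 1) e\<^sub>1\<close>
and \<open>n = -1\<close>, with \<open>e\<^sub>0 = 0\<close>, that it divides \<open>(\<theta> + 1) e\<^sub>1\<close> (degrees taken with half-integral exponents).
So it divides \<open>2 e\<^sub>1\<close>, and the quotient is explicit.
\<close>

lemma inner_modulo_GG_part:
  assumes N: "neutral_derivation D"
  obtains r where "even_skew r" "neutral_derivation (\<lambda>x. D x - n2_diag x r)"
    "\<And>m k l. Poly_Mapping.lookup (D (bas (II m)) - n2_diag (bas (II m)) r) (GP k, GM l) = 0"
proof -
  have D: "skew_derivation D" using N by (simp add: neutral_derivation_def)
  note lin = lin_add[OF skew_derivationD(1)[OF D]] lin_scale[OF skew_derivationD(1)[OF D]]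
    lin_0[OF skew_derivationD(1)[OF D]] lin_minus[OF skew_derivationD(1)[OF D]]
  define e where "e m k l = Poly_Mapping.lookup (D (bas (II m))) (GP k, GM l)" for m k l
  define d where "d n k l = Poly_Mapping.lookup (D (bas (LL n))) (GP k, GM l)" for n k l
  have fe: "finite_support (e m)" and fd: "finite_support (d m)" for m
    unfolding e_def d_def by (intro finite_support_lookup inj_n2_basis)+
  have II: "e n (k - m) l - e n k (l - m) = e m (k - n) l - e m k (l - n)" for m n k l
    using skew_derivation_cocycle[OF D, of "II m" "II n" "GP k" "GM l"]
    by (simp add: lin e_def)
  have e0: "e 0 k l = 0" for k l
    by (rule finite_support_shift_invariant[OF fe])
       (use II[of 0 _ 1 "_ + 1"] in \<open>simp add: add.commute\<close>)
  have LI: "- e (n + 1) k l =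
     (of_int n / 2 - half_idx (k - n)) * e 1 (k - n) l + (of_int n / 2 - half_idx (l - n)) * e 1 k (l - n)
     - (d n (k - 1) l - d n k (l - 1))" for n k l
    using skew_derivation_cocycle[OF D, of "LL n" "II 1" "GP k" "GM l"]
    by (simp add: lin e_def d_def lookup_minus scale_simps)
  \<comment> \<open>Half the difference of the quotients of the two divisibilities just described, obtained from
    \<open>n = 0\<close> and from \<open>n = -1\<close> multiplied by \<open>z\<close>.  In the latter, \<open>f\<close> with coefficients
    \<open>(l + 2) e\<^sub>1(k, l + 1)\<close> occurs as \<open>z f = w f + (z - w) f\<close>, which accounts for the last summand.\<close>
  define u where "u k l = (d 0 k l - d (- 1) (k - 1) l - of_int (l + 2) * e 1 k (l + 1)) / 2" for k l
  have u1: "e 1 k l = u (k - 1) l - u k (l - 1)" for k l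
  proof -
    have A: "d 0 (k - 1) l = d 0 k (l - 1) - of_int (k + l) * e 1 k l"
    proof -
      have "4 * d 0 (k - 1) l = 4 * (d 0 k (l - 1) - of_int (k + l) * e 1 k l)"
        using LI[of 0 k l] by (simp add: field_simps)
      then show ?thesis by (subst (asm) mult_left_cancel) simp_all
    qed
    have B: "d (- 1) (k - 2) l = d (- 1) (k - 1) (l - 1) - of_int (k + 1) * e 1 k l
        - of_int (l + 2) * e 1 (k - 1) (l + 1)"
    proof -
      have "4 * d (- 1) (k - 2) l = 4 * (d (- 1) (k - 1) (l - 1) - of_int (k + 1) * e 1 k l
          - of_int (l + 2) * e 1 (k - 1) (l + 1))"
        using LI[of "- 1" "k - 1" l] by (simp add: e0 field_simps)
      then show ?thesis by (subst (asm) mult_left_cancel) simp_all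
    qed
    show ?thesis by (simp add: u_def A B field_simps)
  qed
  have fu: "finite_support u"
  proof -
    have "finite_support (\<lambda>k l. 1 / 2 * d 0 (k + 0) (l + 0) + (- 1 / 2) * d (- 1) (k + (- 1)) (l + 0))"
      by (intro finite_support_combination fd)
    from finite_support_combination[OF this fe[of 1], of "\<lambda>_ _. 1" 0 0 "\<lambda>k l. - of_int (l + 2) / 2" 0 1]
    have "finite_support (\<lambda>k l. d 0 k l / 2 - d (- 1) (k - 1) l / 2 + (- of_int l - 2) * e 1 k (l + 1) / 2)"
      by simp
    also have "(\<lambda>k l. d 0 k l / 2 - d (- 1) (k - 1) l / 2 + (- of_int l - 2) * e 1 k (l + 1) / 2) = u"
      unfolding u_def by (intro ext) (simp add: diff_divide_distrib add_divide_distrib algebra_simps)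
    finally show ?thesis .
  qed
  have un: "e n k l = u (k - n) l - u k (l - n)" for n k l
  proof -
    let ?f = "\<lambda>k l. 1 * e n (k + 0) (l + 0) + (-1) * (1 * u (k + (- n)) (l + 0) + (-1) * u (k + 0) (l + (- n)))"
    have "finite_support (\<lambda>k l. 1 * e n (k + 0) (l + 0) + (-1) * (1 * u (k + 0 + (- n)) (l + 0 + 0) + (-1) * u (k + 0 + 0) (l + 0 + (- n))))"
      by (intro finite_support_combination fe fu)
    then have "finite_support ?f" by simp
    then have "?f k l = 0"
    proof (rule finite_support_shift_invariant)
      fix i j
      show "?f i j = ?f (i - 1) (j + 1)"
      proof -
        have "e n i j = e n (i - 1) (j + 1) - e 1 (i - n) (j + 1) + e 1 i (j + 1 - n)"
          using II[of n i 1 "j + 1"] by (simp add: algebra_simps)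
        then show ?thesis by (simp add: u1 algebra_simps)
      qed
    qed
    then show ?thesis by (simp add: algebra_simps)
  qed
  obtain r where r: "even_skew r" "Poly_Mapping.lookup r = neutral_tensor (\<lambda>_ _. 0) (\<lambda>_ _. 0) (\<lambda>_ _. 0) u"
    using ex_neutral_tensor[OF finite_support_0 finite_support_0 finite_support_0 fu] by auto
  show thesis
  proof
    show "Poly_Mapping.lookup (D (bas (II m)) - n2_diag (bas (II m)) r) (GP k, GM l) = 0" for m k l
      using un[of m k l] by (simp add: lookup_minus lookup_n2_diag r e_def)
  qed (use r neutral_derivation_diff_inner[OF N] in blast)+
qed

text \<open>
Write \<open>a\<^sub>m\<close> and \<open>b\<^sub>m\<close> for the \<open>L \<otimes> L\<close> and \<open>L \<otimes> I\<close> parts of \<open>D I\<^sub>m\<close> and \<open>g\<^sub>k\<close> for the \<open>L \<otimes> G\<^sup>+\<close> part of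
\<open>D G\<^sup>+\<^sub>k\<close>.  From \<open>[I\<^sub>m, I\<^sub>n] = 0\<close>, \<open>a\<^sub>m\<close> is \<open>m w\<^sup>m\<^sup>-\<^sup>1 a\<^sub>1\<close>, which is skew-symmetric for \<open>m = 1, 2\<close> only
if \<open>a\<^sub>1 = 0\<close>.  From \<open>[I\<^sub>m, G\<^sup>+\<^sub>k] = G\<^sup>+\<^sub>m\<^sub>+\<^sub>k\<close>, \<open>w\<^sup>k b\<^sub>m = g\<^sub>m\<^sub>+\<^sub>k - w\<^sup>m g\<^sub>k\<close>, so that \<open>w\<^sup>-\<^sup>m b\<^sub>m\<close> is additive in
\<open>m\<close>.  The resulting \<open>\<beta>\<close> is skew-symmetric by \<open>[I\<^sub>1, I\<^sub>2] = 0\<close> and can be used as the \<open>L \<otimes> L\<close> part of a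
tensor.
\<close>

lemma inner_modulo_L_parts:
  assumes N: "neutral_derivation D"
    and GG: "\<And>m k l. Poly_Mapping.lookup (D (bas (II m))) (GP k, GM l) = 0"
  obtains r where "even_skew r" "neutral_derivation (\<lambda>x. D x - n2_diag x r)"
    "\<And>m k l. Poly_Mapping.lookup (D (bas (II m)) - n2_diag (bas (II m)) r) (GP k, GM l) = 0"
    "\<And>m i j. Poly_Mapping.lookup (D (bas (II m)) - n2_diag (bas (II m)) r) (LL i, LL j) = 0"
    "\<And>m i j. Poly_Mapping.lookup (D (bas (II m)) - n2_diag (bas (II m)) r) (LL i, II j) = 0"
    "\<And>k i j. Poly_Mapping.lookup (D (bas (GP k)) - n2_diag (bas (GP k)) r) (LL i, GP j) = 0"
proof -
  have D: "skew_derivation D" using N by (simp add: neutral_derivation_def)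
  note lin = lin_add[OF skew_derivationD(1)[OF D]] lin_scale[OF skew_derivationD(1)[OF D]]
    lin_0[OF skew_derivationD(1)[OF D]] lin_minus[OF skew_derivationD(1)[OF D]]
  define a where "a m i j = Poly_Mapping.lookup (D (bas (II m))) (LL i, LL j)" for m i j
  define b where "b m i j = Poly_Mapping.lookup (D (bas (II m))) (LL i, II j)" for m i j
  define g where "g k i j = Poly_Mapping.lookup (D (bas (GP k))) (LL i, GP j)" for k i j
  have fin: "finite_support (a m)" "finite_support (b m)" "finite_support (g m)" for m
    unfolding a_def b_def g_def by (intro finite_support_lookup inj_n2_basis)+
  have GG': "Poly_Mapping.lookup (D (bas (II m))) (GM l, GP k) = 0" for m k l
    using skew_derivationD(2)[OF D, of "II m" "GM l" "GP k"] by (simp add: GG)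
  have b': "Poly_Mapping.lookup (D (bas (II m))) (II j, LL i) = - b m i j" for m i j
    using skew_derivationD(2)[OF D, of "II m" "II j" "LL i"] by (simp add: b_def)
  have a_skew: "a m j i = - a m i j" for m i j
    using skew_derivationD(2)[OF D, of "II m" "LL j" "LL i"] by (simp add: a_def)
  have a_II: "of_int m * a n i (j - m) = of_int n * a m i (j - n)" for m n i j
    using skew_derivation_cocycle[OF D, of "II m" "II n" "LL i" "II j"]
    by (simp add: lin a_def)
  have a2: "a 2 i j = 2 * a 1 i (j - 1)" for i j
    using a_II[of 1 2 i "j + 1"] by simp
  have "a 1 i j = a 1 (i - 1) (j + 1)" for i j
    using a2[of i "j + 1"] a2[of "j + 1" i] a_skew[of 2 i "j + 1"] a_skew[of 1 "j + 1" "i - 1"] by simp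
  then have a1: "a 1 i j = 0" for i j
    using finite_support_shift_invariant[OF fin(1)] by blast
  have a0: "a m i j = 0" for m i j
    using a_II[of 1 m i "j + 1"] a1 by simp
  have b_g: "b m i (j - k) = g (m + k) i j - g k i (j - m)" for m k i j
    using skew_derivation_cocycle[OF D, of "II m" "GP k" "LL i" "GP j"]
    by (simp add: lin GG' a0[unfolded a_def] b_def g_def)
  define \<beta> where "\<beta> i j = b 1 i (j + 1)" for i j
  have b_\<beta>: "b m i (j + m) = of_int m * \<beta> i j" for m i j
    unfolding \<beta>_def
  proof (rule int_additive_linear)
    fix m n
    show "b (m + n) i (j + (m + n)) = b m i (j + m) + b n i (j + n)"
      using b_g[of "m + n" i "j + (m + n)" 0] b_g[of m i "j + (m + n)" n] b_g[of n i "j + n" 0]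
      by (simp add: add.assoc[symmetric] add.commute[of m n])
  qed
  have b_eq: "b m i j = of_int m * \<beta> i (j - m)" for m i j
    using b_\<beta>[of m i "j - m"] by simp
  have g_eq: "g k i j = g 0 i (j - k) + of_int k * \<beta> i (j - k)" for k i j
    using b_g[of k i j 0] b_\<beta>[of k i "j - k"] by (simp add: algebra_simps)
  have f\<beta>: "finite_support \<beta>"
    using finite_support_combination[OF fin(2) fin(2), of "\<lambda>_ _. 1" 1 0 1 "\<lambda>_ _. 0" 1 0 0]
    by (simp add: \<beta>_def[abs_def])
  have \<beta>_skew: "\<beta> j i = - \<beta> i j" for i j
  proof -
    let ?\<sigma> = "\<lambda>i j. 1 * \<beta> i j + 1 * \<beta> j i"
    have "?\<sigma> i j = 0"
    proof (rule finite_support_shift_invariant[where f = ?\<sigma>])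
      show "finite_support ?\<sigma>"
        by (rule finite_support_pointwise[OF f\<beta> finite_support_swap[OF f\<beta>]])
      fix i j
      have "b 2 i (j + 2) - b 2 (j + 1) (i + 1) = 2 * (b 1 (i - 1) (j + 2) - b 1 j (i + 1))"
        using skew_derivation_cocycle[OF D, of "II 1" "II 2" "II (i + 1)" "II (j + 2)"]
        by (simp add: lin b' b_def[symmetric] algebra_simps)
      then have "2 * (\<beta> i j - \<beta> (j + 1) (i - 1)) = 2 * (\<beta> (i - 1) (j + 1) - \<beta> j i)"
        by (simp add: b_eq algebra_simps)
      then have "\<beta> i j - \<beta> (j + 1) (i - 1) = \<beta> (i - 1) (j + 1) - \<beta> j i"
        by (subst (asm) mult_left_cancel) simp_all
      then show "?\<sigma> i j = ?\<sigma> (i - 1) (j + 1)"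
        by (simp add: algebra_simps)
    qed
    then show ?thesis by (simp add: add_eq_0_iff)
  qed
  \<comment> \<open>The tensor \<open>\<beta>\<close> in \<open>L \<otimes> L\<close> accounts for \<open>k \<beta>\<close> in \<open>g\<^sub>k\<close> up to the term \<open>(1/2 - j/2) \<beta>(i, j)\<close>, which
    does not depend on \<open>k\<close>; the \<open>L \<otimes> I\<close> part is chosen to remove this term together with \<open>g\<^sub>0\<close>.\<close>
  define h where "h i j = (- 1) * g 0 i j + (1 / 2 - of_int j / 2) * \<beta> i j" for i j
  have fh: "finite_support h"
    unfolding h_def by (rule finite_support_pointwise[OF fin(3) f\<beta>])
  obtain r where r: "even_skew r" "Poly_Mapping.lookup r = neutral_tensor \<beta> h (\<lambda>_ _. 0) (\<lambda>_ _. 0)"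
    using ex_neutral_tensor[OF f\<beta> fh finite_support_0 finite_support_0 \<beta>_skew] by auto
  show thesis
  proof
    fix m k i j :: int
    show "Poly_Mapping.lookup (D (bas (II m)) - n2_diag (bas (II m)) r) (GP i, GM j) = 0"
      "Poly_Mapping.lookup (D (bas (II m)) - n2_diag (bas (II m)) r) (LL i, LL j) = 0"
      "Poly_Mapping.lookup (D (bas (II m)) - n2_diag (bas (II m)) r) (LL i, II j) = 0"
      using b_eq[of m i j] a0[of m i j]
      by (simp_all add: lookup_minus lookup_n2_diag r GG a_def b_def)
    show "Poly_Mapping.lookup (D (bas (GP k)) - n2_diag (bas (GP k)) r) (LL i, GP j) = 0"
      using g_eq[of k i j] by (simp add: lookup_minus lookup_n2_diag r g_def h_def algebra_simps)
  qed (use r neutral_derivation_diff_inner[OF N] in blast)+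
qed

text \<open>
Once \<open>D\<close> has no \<open>L\<close>-parts on \<open>I\<^sub>m\<close> and \<open>G\<^sup>+\<^sub>k\<close>, the same additivity argument applied to the \<open>I \<otimes> I\<close> part
\<open>d\<^sub>m\<close> of \<open>D I\<^sub>m\<close> gives \<open>d\<^sub>m = m w\<^sup>m \<delta>\<close>, but now skew-symmetry of \<open>d\<^sub>1\<close> and \<open>d\<^sub>2\<close> forces \<open>\<delta> = 0\<close>.  Hence
\<open>D I\<^sub>m = 0\<close>, so \<open>D\<close> commutes with all \<open>I\<^sub>m\<close>, and this leaves on \<open>G\<^sup>\<plusminus>\<^sub>k\<close> only the \<open>I \<otimes> G\<^sup>\<plusminus>\<close> parts
\<open>w\<^sup>k \<eta>\<close> and \<open>w\<^sup>k \<eta>'\<close>.  The value of \<open>2 D L\<^sub>n\<close> computed from \<open>[G\<^sup>+\<^sub>p, G\<^sup>-\<^sub>q]\<close> does not depend on the choice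
of \<open>p + q = n\<close>: the \<open>G\<^sup>+ \<otimes> G\<^sup>-\<close> part gives \<open>\<eta>'(z, w) = \<eta>(w, z)\<close>, the \<open>I \<otimes> I\<close> part \<open>\<eta>' = - \<eta>\<close>.
\<close>

lemma normalised_derivation_inner:
  assumes N: "neutral_derivation D"
    and GG: "\<And>m k l. Poly_Mapping.lookup (D (bas (II m))) (GP k, GM l) = 0"
    and LL: "\<And>m i j. Poly_Mapping.lookup (D (bas (II m))) (LL i, LL j) = 0"
    and LI: "\<And>m i j. Poly_Mapping.lookup (D (bas (II m))) (LL i, II j) = 0"
    and LG: "\<And>k i j. Poly_Mapping.lookup (D (bas (GP k))) (LL i, GP j) = 0"
  obtains r where "even_skew r" "\<And>x. D x = n2_diag x r"
proof -
  have D: "skew_derivation D" and neu: "neutral D" using N by (simp_all add: neutral_derivation_def)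
  note lin = lin_add[OF skew_derivationD(1)[OF D]] lin_scale[OF skew_derivationD(1)[OF D]]
    lin_0[OF skew_derivationD(1)[OF D]] lin_minus[OF skew_derivationD(1)[OF D]]
  define d where "d m i j = Poly_Mapping.lookup (D (bas (II m))) (II i, II j)" for m i j
  define h where "h k i j = Poly_Mapping.lookup (D (bas (GP k))) (II i, GP j)" for k i j
  define g' where "g' k i j = Poly_Mapping.lookup (D (bas (GM k))) (LL i, GM j)" for k i j
  define h' where "h' k i j = Poly_Mapping.lookup (D (bas (GM k))) (II i, GM j)" for k i j
  have fin: "finite_support (d m)" "finite_support (h m)" "finite_support (g' m)" "finite_support (h' m)" for m
    unfolding d_def h_def g'_def h'_def by (intro finite_support_lookup inj_n2_basis)+
  have GG': "Poly_Mapping.lookup (D (bas (II m))) (GM l, GP k) = 0" for m k l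
    using skew_derivationD(2)[OF D, of "II m" "GM l" "GP k"] by (simp add: GG)
  have IL: "Poly_Mapping.lookup (D (bas (II m))) (II j, LL i) = 0" for m i j
    using skew_derivationD(2)[OF D, of "II m" "II j" "LL i"] by (simp add: LI)
  have d_skew: "d m j i = - d m i j" for m i j
    using skew_derivationD(2)[OF D, of "II m" "II j" "II i"] by (simp add: d_def)
  have d_h: "d m i (j - k) = h (m + k) i j - h k i (j - m)" for m k i j
    using skew_derivation_cocycle[OF D, of "II m" "GP k" "II i" "GP j"]
    by (simp add: lin GG' IL LG d_def h_def)
  define \<delta> where "\<delta> i j = d 1 i (j + 1)" for i j
  have d_\<delta>: "d m i (j + m) = of_int m * \<delta> i j" for m i j
    unfolding \<delta>_def
  proof (rule int_additive_linear)
    fix m n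
    show "d (m + n) i (j + (m + n)) = d m i (j + m) + d n i (j + n)"
      using d_h[of "m + n" i "j + (m + n)" 0] d_h[of m i "j + (m + n)" n] d_h[of n i "j + n" 0]
      by (simp add: add.assoc[symmetric] add.commute[of m n])
  qed
  have "\<delta> i j = 0" for i j
  proof (rule finite_support_shift_invariant)
    show "finite_support \<delta>"
      using finite_support_combination[OF fin(1) fin(1), of "\<lambda>_ _. 1" 1 0 1 "\<lambda>_ _. 0" 1 0 0]
      by (simp add: \<delta>_def[abs_def])
    fix i j
    have "\<delta> (i - 1) (j + 1) = - \<delta> (j + 2) (i - 2)"
      using d_\<delta>[of 1 "i - 1" "j + 1"] d_\<delta>[of 1 "j + 2" "i - 2"] d_skew[of 1 "i - 1" "j + 2"]
      by (simp add: add.commute)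
    moreover have "2 * \<delta> (j + 2) (i - 2) = 2 * (- \<delta> i j)"
      using d_\<delta>[of 2 "j + 2" "i - 2"] d_\<delta>[of 2 i j] d_skew[of 2 "j + 2" i] by simp
    ultimately show "\<delta> i j = \<delta> (i - 1) (j + 1)" by simp
  qed
  then have d0: "d m i j = 0" for m i j
    using d_\<delta>[of m i "j - m"] by simp
  have "charge u + charge v \<noteq> 0 \<or> Poly_Mapping.lookup (D (bas (II m))) (u, v) = 0" for m u v
    by (cases u; cases v) (simp_all add: GG GG' LL LI IL d0[unfolded d_def])
  then have D_II: "D (bas (II m)) = 0" for m
    using neu unfolding neutral_def by (intro poly_mapping_eqI) (metis lookup_zero prod.exhaust charge.simps(2))
  have h_eq: "h k i j = h 0 i (j - k)" for k i j
    using d_h[of k i j 0] d0 by simp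
  have g'_shift: "g' (m + k) i j = g' k i (j - m)" for m k i j
    using skew_derivation_cocycle[OF D, of "II m" "GM k" "LL i" "GM j"]
    by (simp add: lin D_II coad_simps g'_def)
  have h'_shift: "h' (m + k) i j = h' k i (j - m) - of_int m * g' k (i - m) j" for m k i j
    using skew_derivation_cocycle[OF D, of "II m" "GM k" "II i" "GM j"]
    by (simp add: lin D_II coad_simps g'_def h'_def minus_equation_iff[of "Poly_Mapping.lookup _ _"])
  have g'_eq: "g' k i j = g' 0 i (j - k)" for k i j
    using g'_shift[of k 0 i j] by simp
  have "g' 0 i j = g' 0 (i - 1) (j + 1)" for i j
  proof -
    have h1: "h' 1 (i + 1) j = h' 0 (i + 1) (j - 1) - g' 0 i j" for i j
      using h'_shift[of 1 0 "i + 1" j] by simp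
    have "h' 2 (i + 1) (j + 1) = h' 1 (i + 1) j - g' 0 i j"
      using h'_shift[of 1 1 "i + 1" "j + 1"] g'_eq[of 1 i "j + 1"] by simp
    moreover have "h' 2 (i + 1) (j + 1) = h' 0 (i + 1) (j - 1) - 2 * g' 0 (i - 1) (j + 1)"
      using h'_shift[of 2 0 "i + 1" "j + 1"] by simp
    ultimately have "2 * g' 0 i j = 2 * g' 0 (i - 1) (j + 1)"
      using h1[of i j] by simp
    then show ?thesis by simp
  qed
  then have "g' 0 i j = 0" for i j
    using finite_support_shift_invariant[OF fin(3)] by blast
  then have g'0: "g' k i j = 0" for k i j
    using g'_eq by metis
  have h'_eq: "h' k i j = h' 0 i (j - k)" for k i j
    using h'_shift[of k 0 i j] g'0 by simp
  define \<eta> where "\<eta> = h 0"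
  define \<eta>' where "\<eta>' = h' 0"
  have GI: "Poly_Mapping.lookup (D (bas (GP k))) (GP i, II j) = - \<eta> j (i - k)"
      "Poly_Mapping.lookup (D (bas (GP k))) (II j, GP i) = \<eta> j (i - k)"
      "Poly_Mapping.lookup (D (bas (GM k))) (GM i, II j) = - \<eta>' j (i - k)"
      "Poly_Mapping.lookup (D (bas (GM k))) (II j, GM i) = \<eta>' j (i - k)"
      "Poly_Mapping.lookup (D (bas (GP k))) (GP i, LL j) = 0"
      "Poly_Mapping.lookup (D (bas (GM k))) (GM i, LL j) = 0"
      "Poly_Mapping.lookup (D (bas (GM k))) (LL j, GM i) = 0" for k i j
    using skew_derivationD(2)[OF D, of "GP k" "GP i" "II j"] skew_derivationD(2)[OF D, of "GM k" "GM i" "II j"]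
      skew_derivationD(2)[OF D, of "GP k" "GP i" "LL j"] skew_derivationD(2)[OF D, of "GM k" "GM i" "LL j"]
      h_eq[of k j i] h'_eq[of k j i] g'0[of k j i]
    by (simp_all add: h_def h'_def g'_def LG \<eta>_def \<eta>'_def)
  have f\<eta>: "finite_support \<eta>" "finite_support \<eta>'"
    unfolding \<eta>_def \<eta>'_def by (rule fin)+
  have L_GG: "2 * Poly_Mapping.lookup (D (bas (LL (k + l + 1)))) (GP i, GM j) = \<eta> (j - l) (i - k) - \<eta>' (i - k) (j - l)"
    for k l i j
    using skew_derivation_cocycle[OF D, of "GP k" "GM l" "GP i" "GM j"]
    by (simp add: lin lookup_add D_II GI)
  have \<eta>'_transpose: "\<eta>' i j = \<eta> j i" for i j
  proof -
    have "1 * \<eta>' i j + (- 1) * \<eta> j i = 0"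
    proof (rule finite_support_shift_invariant[where f = "\<lambda>i j. 1 * \<eta>' i j + (- 1) * \<eta> j i"])
      show "finite_support (\<lambda>i j. 1 * \<eta>' i j + (- 1) * \<eta> j i)"
        by (intro finite_support_pointwise f\<eta> finite_support_swap[OF f\<eta>(1)])
      show "1 * \<eta>' i j + (- 1) * \<eta> j i = 1 * \<eta>' (i - 1) (j + 1) + (- 1) * \<eta> (j + 1) (i - 1)" for i j
      proof -
        have "\<eta> j i - \<eta>' i j = \<eta> (j + 1) (i - 1) - \<eta>' (i - 1) (j + 1)"
          using L_GG[of 0 0 i j] L_GG[of 1 "- 1" i j] by simp
        from arg_cong[OF this, of uminus] show ?thesis by simp
      qed
    qed
    then show ?thesis by simp
  qed
  have L_II: "2 * Poly_Mapping.lookup (D (bas (LL (k + l + 1)))) (II i, II j) =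
      - (of_int (2 * k + 1 - i) * \<eta>' j (i - k - 1 - l)) + of_int (2 * k + 1 - j) * \<eta>' i (j - k - 1 - l)
      - of_int (i - 1 - 2 * l) * \<eta> j (i - l - 1 - k) + of_int (j - 1 - 2 * l) * \<eta> i (j - l - 1 - k)"
    for k l i j
    using skew_derivation_cocycle[OF D, of "GP k" "GM l" "II i" "II j"]
    by (simp add: lin lookup_add D_II GI)
  \<comment> \<open>The pairs \<open>(0, n - 1)\<close> and \<open>(1, n - 2)\<close> of indices of \<open>G\<^sup>+\<close> and \<open>G\<^sup>-\<close> lead to the same \<open>L\<^sub>n\<close>.  In the
    difference of the two equations only the part of \<open>[G\<^sup>+\<^sub>p, G\<^sup>-\<^sub>q]\<close> proportional to \<open>p - q\<close> survives.\<close>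
  have \<psi>: "\<eta> i j + \<eta>' i j = \<eta> (j + n) (i - n) + \<eta>' (j + n) (i - n)" for i j n
  proof -
    have "2 * (\<eta> i j + \<eta>' i j) = 2 * (\<eta> (j + n) (i - n) + \<eta>' (j + n) (i - n))"
    proof -
      let ?R = "\<lambda>k l. - (of_int (2 * k + 1 - i) * \<eta>' (j + n) (i - n)) +
        of_int (2 * k + 1 - (j + n)) * \<eta>' i j - of_int (i - 1 - 2 * l) * \<eta> (j + n) (i - n) +
        of_int (j + n - 1 - 2 * l) * \<eta> i j"
      have "?R 0 (n - 1) = ?R 1 (n - 2)"
        using L_II[of 0 "n - 1" i "j + n"] L_II[of 1 "n - 2" i "j + n"] by simp
      moreover have "2 * (\<eta> i j + \<eta>' i j) - 2 * (\<eta> (j + n) (i - n) + \<eta>' (j + n) (i - n)) =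
          ?R 1 (n - 2) - ?R 0 (n - 1)"
        by (simp add: algebra_simps)
      ultimately show ?thesis by simp
    qed
    then show ?thesis by (subst (asm) mult_left_cancel) simp_all
  qed
  have \<eta>'_neg: "\<eta>' i j = - \<eta> i j" for i j
  proof -
    have "1 * \<eta>' i j + 1 * \<eta> i j = 0"
    proof (rule finite_support_shift_invariant[where f = "\<lambda>i j. 1 * \<eta>' i j + 1 * \<eta> i j"])
      show "finite_support (\<lambda>i j. 1 * \<eta>' i j + 1 * \<eta> i j)"
        by (intro finite_support_pointwise f\<eta>)
      show "1 * \<eta>' i j + 1 * \<eta> i j = 1 * \<eta>' (i - 1) (j + 1) + 1 * \<eta> (i - 1) (j + 1)" for i j
        using \<psi>[of i j 0] \<psi>[of "i - 1" "j + 1" "- 1"] by (simp add: algebra_simps)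
    qed
    then show ?thesis by (simp add: add_eq_0_iff2)
  qed
  have f: "finite_support (\<lambda>i j. - \<eta> i j)"
    using finite_support_pointwise[OF f\<eta>, of "\<lambda>_ _. - 1" "\<lambda>_ _. 0"] by simp
  have skew: "- \<eta> j i = - (- \<eta> i j)" for i j
    using \<eta>'_neg[of i j] \<eta>'_transpose[of i j] by simp
  have skew': "\<eta> (i - k) j = - \<eta> j (i - k)" for i j k
    using skew[of j "i - k"] by simp
  obtain r where r: "even_skew r"
     "Poly_Mapping.lookup r = neutral_tensor (\<lambda>_ _. 0) (\<lambda>_ _. 0) (\<lambda>i j. - \<eta> i j) (\<lambda>_ _. 0)"
    using ex_neutral_tensor[OF finite_support_0 finite_support_0 f finite_support_0 _ skew] by auto
  \<comment> \<open>It suffices that the difference kills \<open>I\<^sub>m\<close> and \<open>G\<^sup>\<plusminus>\<^sub>k\<close>, since each \<open>L\<^sub>n\<close> is a combination of some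
    \<open>[G\<^sup>+\<^sub>k, G\<^sup>-\<^sub>l]\<close> and an \<open>I\<^sub>n\<close>.\<close>
  define E where "E = (\<lambda>x. D x - n2_diag x r)"
  have "neutral_derivation E"
    unfolding E_def by (rule neutral_derivation_diff_inner[OF N r])
  then have E: "skew_derivation E" and neuE: "neutral E" by (simp_all add: neutral_derivation_def)
  have E_II: "E (bas (II m)) = 0" for m
  proof (rule poly_mapping_eqI)
    fix p :: "n2_basis \<times> n2_basis"
    obtain u v where p: "p = (u, v)" by (cases p)
    show "Poly_Mapping.lookup (E (bas (II m))) p = Poly_Mapping.lookup 0 p"
      unfolding p E_def by (cases u; cases v) (simp_all add: lookup_minus D_II lookup_n2_diag r)
  qed
  have E_G: "E (bas (GP k)) = 0" "E (bas (GM k)) = 0" for k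
  proof -
    have *: "Poly_Mapping.lookup (E (bas (GP k))) (u, v) = 0" "Poly_Mapping.lookup (E (bas (GM k))) (u, v) = 0" for u v
    proof -
      have "charge u + charge v \<noteq> charge (GP k) \<or> Poly_Mapping.lookup (E (bas (GP k))) (u, v) = 0"
        unfolding E_def
        by (cases u; cases v) (simp_all add: lookup_minus lookup_n2_diag r GI LG skew')
      then show "Poly_Mapping.lookup (E (bas (GP k))) (u, v) = 0"
        using neuE unfolding neutral_def by blast
      have "charge u + charge v \<noteq> charge (GM k) \<or> Poly_Mapping.lookup (E (bas (GM k))) (u, v) = 0"
        unfolding E_def
        by (cases u; cases v) (simp_all add: lookup_minus lookup_n2_diag r GI \<eta>'_neg skew')
      then show "Poly_Mapping.lookup (E (bas (GM k))) (u, v) = 0"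
        using neuE unfolding neutral_def by blast
    qed
    show "E (bas (GP k)) = 0" "E (bas (GM k)) = 0"
      by (rule poly_mapping_eqI, metis * lookup_zero prod.exhaust)+
  qed
  have "E (bas (LL m)) = 0" for m
  proof -
    have "scale 2 (E (bas (LL m))) = 0"
      using skew_derivationD(4)[OF E, of "GP (m - 1)" "GM 0"]
      by (simp add: lin_add[OF skew_derivationD(1)[OF E]] lin_scale[OF skew_derivationD(1)[OF E]]
          E_II E_G lin_0[OF lin_n2_diag(1)] scale_simps)
    then show ?thesis
      by (metis scale_simps(3,4,6) mult.commute nonzero_eq_divide_eq zero_neq_numeral scale_simps(2))
  qed
  then have "E (bas b) = 0" for b
    by (cases b) (simp_all add: E_II E_G)
  then have "E x = 0" for x
    using lin_eqI[OF skew_derivationD(1)[OF E], of "\<lambda>_. 0"] by (simp add: lin_iff scale_simps)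
  then show thesis
    using that[OF r(1)] by (simp add: E_def)
qed

section \<open>Maps on the threefold tensor power\<close>

lemma tensor_map_tensor:
  assumes "lin f" "lin g"
  shows "tensor_map f g (p \<otimes> q) = f p \<otimes> g q"
proof (rule lin_eqI[where x = p])
  have l: "lin (tensor_map f g)" unfolding tensor_map_def by (rule lin_lin_ext)
  note s = lin_add[OF l] lin_scale[OF l] lin_add[OF assms(1)] lin_scale[OF assms(1)]
    lin_add[OF assms(2)] lin_scale[OF assms(2)] tensor_simps lin_iff
  show "lin (\<lambda>p. tensor_map f g (p \<otimes> q))" "lin (\<lambda>p. f p \<otimes> g q)"
    by (simp_all add: s)
  fix b
  show "tensor_map f g (bas b \<otimes> q) = f (bas b) \<otimes> g q"
  proof (rule lin_eqI[where x = q])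
    show "lin (\<lambda>q. tensor_map f g (bas b \<otimes> q))" "lin (\<lambda>q. f (bas b) \<otimes> g q)"
      by (simp_all add: s)
  qed (simp add: tensor_bas tensor_map_def)
qed

lemma lin_tensor_map: "lin (tensor_map f g)"
  unfolding tensor_map_def by (rule lin_lin_ext)

lemma lookup_tensor_map_bracket:
  "Poly_Mapping.lookup (tensor_map (n2_bracket (bas x)) id t) (u, w) =
     coad x u (\<lambda>a. Poly_Mapping.lookup t (a, w))"
proof -
  have "Poly_Mapping.lookup (tensor_map (n2_bracket (bas x)) id t) (u, w) =
     (\<Sum>p\<in>Poly_Mapping.keys t. Poly_Mapping.lookup t p *
       (coad x u (Poly_Mapping.lookup (bas (fst p))) * Poly_Mapping.lookup (bas (snd p)) w))"
    unfolding tensor_map_def lookup_lin_ext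
    by (intro sum.cong refl) (auto simp: coad_bas n2_bracket_simps)
  moreover
  have "(\<lambda>a. Poly_Mapping.lookup t (a, w)) = (\<lambda>a. \<Sum>p\<in>Poly_Mapping.keys t.
     (Poly_Mapping.lookup t p * Poly_Mapping.lookup (bas (snd p)) w) * Poly_Mapping.lookup (bas (fst p)) a)"
    by (rule ext, subst lookup_expansion) (auto simp: lookup_single when_def intro!: sum.cong)
  then have "coad x u (\<lambda>a. Poly_Mapping.lookup t (a, w)) = (\<Sum>p\<in>Poly_Mapping.keys t.
     (Poly_Mapping.lookup t p * Poly_Mapping.lookup (bas (snd p)) w) *
       coad x u (Poly_Mapping.lookup (bas (fst p))))"
    by (simp only: coad_sum)
  ultimately show ?thesis
    by (simp add: mult_ac)
qed

lemma lookup_super_cyclic: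
  "Poly_Mapping.lookup (super_cyclic par t) (b, c, a) =
     sgn2 (par a * (par b + par c)) * Poly_Mapping.lookup t (a, b, c)"
proof -
  have "Poly_Mapping.lookup (super_cyclic par t) (b, c, a) =
    (\<Sum>p\<in>Poly_Mapping.keys t. if p = (a, b, c) then sgn2 (par a * (par b + par c)) * Poly_Mapping.lookup t (a, b, c) else 0)"
    unfolding super_cyclic_def lookup_lin_ext
    by (intro sum.cong refl) (auto simp: lookup_single when_def split: if_splits)
  then show ?thesis by (simp add: in_keys_iff)
qed

lemma lin_super_cyclic: "lin (super_cyclic par)"
  unfolding super_cyclic_def by (rule lin_lin_ext)

lemma super_cyclic_cubed: "super_cyclic par (super_cyclic par (super_cyclic par t)) = t"
proof (rule poly_mapping_eqI)
  fix k :: "'a \<times> 'a \<times> 'a"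
  obtain a b c where k: "k = (a, b, c)" by (cases k)
  show "Poly_Mapping.lookup (super_cyclic par (super_cyclic par (super_cyclic par t))) k =
      Poly_Mapping.lookup t k"
    unfolding k lookup_super_cyclic
    by (cases "par a"; cases "par b"; cases "par c"; simp)
qed

lemma super_cyclic_tensor:
  assumes "p \<in> homog par i" "q \<in> homog par j" "w \<in> homog par k"
  shows "super_cyclic par (p \<otimes> q \<otimes> w) = scale (sgn2 (i * (j + k))) (q \<otimes> w \<otimes> p)"
proof (rule poly_mapping_eqI)
  fix k' :: "'a \<times> 'a \<times> 'a"
  obtain b c a where k: "k' = (b, c, a)" by (cases k')
  consider "Poly_Mapping.lookup p a = 0" | "Poly_Mapping.lookup q b = 0" | "Poly_Mapping.lookup w c = 0"
    | "par a = i" "par b = j" "par c = k"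
  proof -
    have "par a = i" if "Poly_Mapping.lookup p a \<noteq> 0"
      using assms(1) that by (simp add: homog_def in_keys_iff)
    moreover have "par b = j" if "Poly_Mapping.lookup q b \<noteq> 0"
      using assms(2) that by (simp add: homog_def in_keys_iff)
    moreover have "par c = k" if "Poly_Mapping.lookup w c \<noteq> 0"
      using assms(3) that by (simp add: homog_def in_keys_iff)
    ultimately show thesis using that by blast
  qed
  then show "Poly_Mapping.lookup (super_cyclic par (p \<otimes> q \<otimes> w)) k' =
      Poly_Mapping.lookup (scale (sgn2 (i * (j + k))) (q \<otimes> w \<otimes> p)) k'"
    unfolding k lookup_super_cyclic by cases simp_all
qed

section \<open>The co-Jacobi identity for an inner cobracket\<close>

text \<open>
Both \<open>c(r)\<close> and the co-Jacobi expression are quadratic in \<open>r = \<Sum> a \<otimes> b\<close>, that is, sums over two copies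
\<open>a \<otimes> b\<close> and \<open>c \<otimes> d\<close> of \<open>r\<close>.  Identities between such sums are proved termwise, up to the exchange of
\<open>a\<close> with \<open>b\<close>, of \<open>c\<close> with \<open>d\<close>, or of the two copies.
\<close>

definition quad ::
  "(n2_basis \<times> n2_basis \<Rightarrow>\<^sub>0 complex) \<Rightarrow>
     (n2_basis \<Rightarrow> n2_basis \<Rightarrow> n2_basis \<Rightarrow> n2_basis \<Rightarrow> ('c \<Rightarrow>\<^sub>0 complex)) \<Rightarrow> ('c \<Rightarrow>\<^sub>0 complex)" where
  "quad r F = bilin_ext (\<lambda>(a, b) (c, d). F a b c d) r r"

lemma quad_sum:
  "quad r F = (\<Sum>p\<in>Poly_Mapping.keys r. \<Sum>q\<in>Poly_Mapping.keys r.
     scale (Poly_Mapping.lookup r p * Poly_Mapping.lookup r q) (F (fst p) (snd p) (fst q) (snd q)))"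
  unfolding quad_def bilin_ext_def lin_ext_def
  by (simp add: scale_sum scale_simps case_prod_beta)

lemma quad_add: "quad r (\<lambda>a b c d. F a b c d + G a b c d) = quad r F + quad r G"
  by (simp add: quad_sum scale_simps sum.distrib)

lemma quad_minus: "quad r (\<lambda>a b c d. - F a b c d) = - quad r F"
  by (simp add: quad_sum scale_simps sum_negf)

lemma lin_quad: "lin f \<Longrightarrow> f (quad r F) = quad r (\<lambda>a b c d. f (F a b c d))"
  by (simp add: quad_sum lin_sum lin_scale)

lemma quad_swap: "quad r (\<lambda>a b c d. F c d a b) = quad r F"
  unfolding quad_sum by (subst sum.swap) (simp add: mult.commute)

lemma quad_cong:
  assumes "even_skew r"
    and "\<And>a b c d. n2_par a = n2_par b \<Longrightarrow> n2_par c = n2_par d \<Longrightarrow> F a b c d = G a b c d"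
  shows "quad r F = quad r G"
proof -
  have "n2_par (fst p) = n2_par (snd p)" if "p \<in> Poly_Mapping.keys r" for p
    using even_skewD(2)[OF assms(1), of "fst p" "snd p"] that by (auto simp: in_keys_iff)
  then show ?thesis
    unfolding quad_sum by (auto intro!: sum.cong simp: assms(2))
qed

lemma lin_ext_super_twist:
  "lin_ext f (super_twist n2_par r) = lin_ext (\<lambda>(a, b). scale (koszul a b) (f (b, a))) r"
proof (rule lin_eqI[where x = r])
  show "lin (\<lambda>r. lin_ext f (super_twist n2_par r))"
    unfolding super_twist_def lin_iff
    by (simp add: lin_add[OF lin_lin_ext] lin_scale[OF lin_lin_ext])
  show "lin (lin_ext (\<lambda>(a, b). scale (koszul a b) (f (b, a))))" by (rule lin_lin_ext)
qed (auto simp: super_twist_def lin_scale[OF lin_lin_ext])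

lemma super_twist_even_skew: "even_skew r \<Longrightarrow> super_twist n2_par r = - r"
proof (rule poly_mapping_eqI)
  fix k :: "n2_basis \<times> n2_basis"
  assume r: "even_skew r"
  obtain v u where k: "k = (v, u)" by (cases k)
  show "Poly_Mapping.lookup (super_twist n2_par r) k = Poly_Mapping.lookup (- r) k"
    using even_skewD(1)[OF r, of v u] by (simp add: k lookup_super_twist lookup_minus)
qed

lemma quad_skew_left:
  assumes "even_skew r"
  shows "quad r (\<lambda>a b c d. scale (koszul a b) (F b a c d)) = - quad r F"
proof -
  let ?f = "\<lambda>(a, b). lin_ext (\<lambda>(c, d). F a b c d) r"
  have "quad r (\<lambda>a b c d. scale (koszul a b) (F b a c d)) = lin_ext (\<lambda>(a, b). scale (koszul a b) (?f (b, a))) r"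
    unfolding quad_def bilin_ext_def
    by (rule lin_ext_cong) (auto simp: lin_ext_def scale_sum scale_simps mult.commute case_prod_beta)
  also have "\<dots> = lin_ext ?f (- r)"
    by (simp only: lin_ext_super_twist[symmetric] super_twist_even_skew[OF assms])
  also have "\<dots> = - quad r F"
    by (auto simp: lin_minus[OF lin_lin_ext] quad_def bilin_ext_def intro!: lin_ext_cong)
  finally show ?thesis .
qed

lemma quad_skew_right:
  assumes "even_skew r"
  shows "quad r (\<lambda>a b c d. scale (koszul c d) (F a b d c)) = - quad r F"
  using quad_skew_left[OF assms, of "\<lambda>c d a b. F a b c d"]
    quad_swap[of r "\<lambda>a b c d. scale (koszul c d) (F a b d c)"] quad_swap[of r F] by simp

lemma cybe_quad:
  "cybe n2_par n2_bracket r =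
     quad r (\<lambda>a b c d. scale (koszul c b) (n2_bracket_basis a c \<otimes> bas b \<otimes> bas d)) +
     quad r (\<lambda>a b c d. bas a \<otimes> n2_bracket_basis b c \<otimes> bas d) +
     quad r (\<lambda>a b c d. scale (koszul c b) (bas a \<otimes> bas c \<otimes> n2_bracket_basis b d))"
  unfolding cybe_def r12_r13_def r12_r23_def r13_r23_def quad_def
  by (simp add: n2_bracket_simps)

lemma inner_cobracket_twice:
  assumes "even_skew r"
  shows "tensor_map id (\<lambda>x. n2_diag x r) (n2_diag (bas x) r) =
    quad r (\<lambda>a b c d. n2_bracket_basis x a \<otimes> n2_bracket_basis b c \<otimes> bas d
       + scale (koszul c b) (n2_bracket_basis x a \<otimes> bas c \<otimes> n2_bracket_basis b d)) +
    quad r (\<lambda>a b c d. scale (koszul x a) (bas a \<otimes> n2_bracket (n2_bracket_basis x b) (bas c) \<otimes> bas d)) +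
    quad r (\<lambda>a b c d. scale (koszul x a * sgn2 ((n2_par x + n2_par b) * n2_par c))
       (bas a \<otimes> bas c \<otimes> n2_bracket (n2_bracket_basis x b) (bas d)))"
proof -
  let ?D = "\<lambda>x. n2_diag x r"
  have hom: "n2_bracket_basis u v \<in> homog n2_par (n2_par u + n2_par v)"  "bas u \<in> homog n2_par (n2_par u)" for u v
    by (rule n2_bracket_basis_homog, rule homog_bas, rule refl)
  have lid: "lin (id :: (n2_basis \<Rightarrow>\<^sub>0 complex) \<Rightarrow> _)" by (simp add: lin_iff)
  have D: "?D y = lin_ext (\<lambda>p. n2_diag y (bas p)) r" for y
    by (rule lin_eqI[OF lin_n2_diag(1) lin_lin_ext]) simp
  have push: "f (lin_ext g r) = lin_ext (\<lambda>p. f (g p)) r" if "lin f" for f g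
    unfolding lin_ext_def by (simp add: lin_sum[OF that] lin_scale[OF that])
  have lt: "lin (\<lambda>y. p \<otimes> y)" for p by (simp add: lin_iff tensor_simps)
  have "tensor_map id ?D (?D (bas x)) = lin_ext (\<lambda>p. tensor_map id ?D (n2_diag (bas x) (bas p))) r"
    by (subst (2) D) (rule push[OF lin_tensor_map])
  also have "\<dots> = quad r (\<lambda>a b c d. n2_bracket_basis x a \<otimes> n2_diag (bas b) (bas (c, d)) +
      scale (koszul x a) (bas a \<otimes> n2_diag (n2_bracket_basis x b) (bas (c, d))))"
  proof -
    have "tensor_map id ?D (n2_diag (bas x) (bas (a, b))) =
      lin_ext (\<lambda>(c, d). n2_bracket_basis x a \<otimes> n2_diag (bas b) (bas (c, d)) +
        scale (koszul x a) (bas a \<otimes> n2_diag (n2_bracket_basis x b) (bas (c, d)))) r" for a b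
    proof -
      have "tensor_map id ?D (n2_diag (bas x) (bas (a, b))) =
        n2_bracket_basis x a \<otimes> ?D (bas b) + scale (koszul x a) (bas a \<otimes> ?D (n2_bracket_basis x b))"
        by (simp add: tensor_bas[symmetric] n2_diag_tensor[OF hom(2) hom(2)] lin_add[OF lin_tensor_map]
            lin_scale[OF lin_tensor_map] tensor_map_tensor[OF lid lin_n2_diag(2)] n2_bracket_simps)
      also have "\<dots> = lin_ext (\<lambda>p. n2_bracket_basis x a \<otimes> n2_diag (bas b) (bas p)) r +
          scale (koszul x a) (lin_ext (\<lambda>p. bas a \<otimes> n2_diag (n2_bracket_basis x b) (bas p)) r)"
        by (subst (1 2) D) (simp only: push[OF lt])
      also have "\<dots> = lin_ext (\<lambda>(c, d). n2_bracket_basis x a \<otimes> n2_diag (bas b) (bas (c, d)) +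
        scale (koszul x a) (bas a \<otimes> n2_diag (n2_bracket_basis x b) (bas (c, d)))) r"
        by (simp add: lin_ext_def scale_sum scale_simps sum.distrib case_prod_beta mult.commute)
      finally show ?thesis .
    qed
    then show ?thesis
      unfolding quad_def bilin_ext_def by (intro lin_ext_cong) auto
  qed
  also have "\<dots> = quad r (\<lambda>a b c d. (n2_bracket_basis x a \<otimes> n2_bracket_basis b c \<otimes> bas d
       + scale (koszul c b) (n2_bracket_basis x a \<otimes> bas c \<otimes> n2_bracket_basis b d)) +
       (scale (koszul x a) (bas a \<otimes> n2_bracket (n2_bracket_basis x b) (bas c) \<otimes> bas d) +
       scale (koszul x a * sgn2 ((n2_par x + n2_par b) * n2_par c))
       (bas a \<otimes> bas c \<otimes> n2_bracket (n2_bracket_basis x b) (bas d))))"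
    by (rule quad_cong[OF assms])
      (simp add: tensor_bas[symmetric] n2_diag_tensor[OF hom(2) hom(2)] n2_diag_tensor[OF hom(1) hom(2)]
        n2_bracket_simps tensor_simps scale_simps mult.commute)
  finally show ?thesis by (simp only: quad_add add.assoc)
qed

lemma n2_bracket_skew:
  assumes "p \<in> homog n2_par i" "q \<in> homog n2_par j"
  shows "n2_bracket p q = - scale (sgn2 (i * j)) (n2_bracket q p)"
  using lie_superalgebra_n2 assms unfolding lie_superalgebra_def by blast

lemma n2_bracket_homog:
  assumes "p \<in> homog n2_par i" "q \<in> homog n2_par j"
  shows "n2_bracket p q \<in> homog n2_par (i + j)"
  using lie_superalgebra_n2 assms unfolding lie_superalgebra_def by blast

text \<open>
By \<open>inner_cobracket_twice\<close>, \<open>(1 \<otimes> \<Delta>) (\<Delta> x) = t\<^sub>1 + t\<^sub>2 + t\<^sub>3\<close>, where \<open>x\<close> acts on the \<open>i\<close>-th factor in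
\<open>t\<^sub>i\<close>.  Moving \<open>x\<close> to the front, \<open>t\<^sub>1 + \<xi> t\<^sub>2 + \<xi>\<^sup>2 t\<^sub>3\<close> turns out to be \<open>(ad x \<otimes> 1 \<otimes> 1) c(r)\<close>: \<open>t\<^sub>1\<close> gives
the terms \<open>[r\<^sup>1\<^sup>2, r\<^sup>2\<^sup>3]\<close> and \<open>[r\<^sup>1\<^sup>3, r\<^sup>2\<^sup>3]\<close> of \<open>c(r)\<close>, and \<open>\<xi> t\<^sub>2 + \<xi>\<^sup>2 t\<^sub>3\<close> gives \<open>[r\<^sup>1\<^sup>2, r\<^sup>1\<^sup>3]\<close> by the Jacobi
identity.  As \<open>\<xi>\<^sup>3 = 1\<close>, rotating the summands does not change the cyclic sum.
\<close>

lemma co_jacobi_sum_cybe: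
  fixes x :: n2_basis
  assumes r: "even_skew r"
  defines "t \<equiv> tensor_map id (\<lambda>x. n2_diag x r) (n2_diag (bas x) r)"
    and "y \<equiv> tensor_map (n2_bracket (bas x)) id (cybe n2_par n2_bracket r)"
  shows "t + super_cyclic n2_par t + super_cyclic n2_par (super_cyclic n2_par t) =
    y + super_cyclic n2_par y + super_cyclic n2_par (super_cyclic n2_par y)"
proof -
  let ?\<xi> = "super_cyclic n2_par"
  note \<xi> = lin_add[OF lin_super_cyclic] lin_scale[OF lin_super_cyclic] lin_minus[OF lin_super_cyclic]
  note \<tau> = lin_tensor_map[of "n2_bracket (bas x)" id]
  have hom: "n2_bracket_basis u v \<in> homog n2_par (n2_par u + n2_par v)" "bas u \<in> homog n2_par (n2_par u)"
     "n2_bracket (n2_bracket_basis u v) (bas w) \<in> homog n2_par (n2_par u + n2_par v + n2_par w)" for u v w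
    by (rule n2_bracket_basis_homog, rule homog_bas, rule refl)
      (intro n2_bracket_homog n2_bracket_basis_homog homog_bas refl)
  have lid: "lin (id :: (n2_basis \<times> n2_basis \<Rightarrow>\<^sub>0 complex) \<Rightarrow> _)" by (simp add: lin_iff)
  have T: "tensor_map (n2_bracket (bas x)) id (p \<otimes> q) = n2_bracket (bas x) p \<otimes> q"
    for p and q :: "n2_basis \<times> n2_basis \<Rightarrow>\<^sub>0 complex"
    using tensor_map_tensor[OF n2_br_lin(1) lid, of "bas x" p q] by simp
  define t1 where "t1 = quad r (\<lambda>a b c d. n2_bracket_basis x a \<otimes> n2_bracket_basis b c \<otimes> bas d
       + scale (koszul c b) (n2_bracket_basis x a \<otimes> bas c \<otimes> n2_bracket_basis b d))"
  define t2 where "t2 = quad r (\<lambda>a b c d. scale (koszul x a)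
       (bas a \<otimes> n2_bracket (n2_bracket_basis x b) (bas c) \<otimes> bas d))"
  define t3 where "t3 = quad r (\<lambda>a b c d. scale (koszul x a * sgn2 ((n2_par x + n2_par b) * n2_par c))
       (bas a \<otimes> bas c \<otimes> n2_bracket (n2_bracket_basis x b) (bas d)))"
  have t: "t = t1 + t2 + t3"
    unfolding t_def t1_def t2_def t3_def by (rule inner_cobracket_twice[OF r])
  have \<xi>t2: "?\<xi> t2 = - quad r (\<lambda>a b c d. n2_bracket (n2_bracket_basis x a) (bas c) \<otimes> bas d \<otimes> bas b)"
  proof -
    have "?\<xi> t2 = quad r (\<lambda>a b c d. scale (koszul a b)
        (n2_bracket (n2_bracket_basis x b) (bas c) \<otimes> bas d \<otimes> bas a))"
      unfolding t2_def lin_quad[OF lin_super_cyclic]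
    proof (rule quad_cong[OF r])
      fix a b c d assume p: "n2_par a = n2_par b" "n2_par c = n2_par d"
      show "?\<xi> (scale (koszul x a) (bas a \<otimes> n2_bracket (n2_bracket_basis x b) (bas c) \<otimes> bas d)) =
        scale (koszul a b) (n2_bracket (n2_bracket_basis x b) (bas c) \<otimes> bas d \<otimes> bas a)"
        unfolding \<xi> super_cyclic_tensor[OF hom(2) hom(3) hom(2)] scale_simps p
        by (cases "n2_par x"; cases "n2_par b"; cases "n2_par d"; simp)
    qed
    also have "\<dots> = - quad r (\<lambda>a b c d. n2_bracket (n2_bracket_basis x a) (bas c) \<otimes> bas d \<otimes> bas b)"
      by (rule quad_skew_left[OF r])
    finally show ?thesis .
  qed
  have \<xi>t3: "?\<xi> (?\<xi> t3) = quad r (\<lambda>a b c d. scale (koszul c b)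
      (n2_bracket (n2_bracket_basis x a) (bas c) \<otimes> bas b \<otimes> bas d))" (is "_ = quad r ?H")
  proof -
    have "?\<xi> (?\<xi> t3) = quad r (\<lambda>a b c d. scale (koszul a b) (scale (koszul c d) (?H b a d c)))"
      unfolding t3_def lin_quad[OF lin_super_cyclic]
    proof (rule quad_cong[OF r])
      fix a b c d assume p: "n2_par a = n2_par b" "n2_par c = n2_par d"
      show "?\<xi> (?\<xi> (scale (koszul x a * sgn2 ((n2_par x + n2_par b) * n2_par c))
         (bas a \<otimes> bas c \<otimes> n2_bracket (n2_bracket_basis x b) (bas d)))) =
         scale (koszul a b) (scale (koszul c d) (?H b a d c))"
        unfolding \<xi> super_cyclic_tensor[OF hom(2) hom(2) hom(3)] super_cyclic_tensor[OF hom(2) hom(3) hom(2)]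
           scale_simps p
        by (cases "n2_par x"; cases "n2_par b"; cases "n2_par d"; simp)
    qed
    also have "\<dots> = - quad r (\<lambda>a b c d. scale (koszul c d) (?H a b d c))"
      by (rule quad_skew_left[OF r, of "\<lambda>a b c d. scale (koszul c d) (?H a b d c)"])
    also have "\<dots> = quad r ?H"
      using quad_skew_right[OF r, of ?H] by simp
    finally show ?thesis .
  qed
  have "y = t1 + ?\<xi> t2 + ?\<xi> (?\<xi> t3)"
  proof -
    have "tensor_map (n2_bracket (bas x)) id
        (quad r (\<lambda>a b c d. scale (koszul c b) (n2_bracket_basis a c \<otimes> bas b \<otimes> bas d))) =
      quad r (\<lambda>a b c d. ?H a b c d + - (n2_bracket (n2_bracket_basis x c) (bas a) \<otimes> bas b \<otimes> bas d))"
      unfolding lin_quad[OF lin_tensor_map]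
    proof (rule quad_cong[OF r])
      fix a b c d assume p: "n2_par a = n2_par b" "n2_par c = n2_par d"
      have jac: "n2_bracket (bas x) (n2_bracket_basis a c) = n2_bracket (n2_bracket_basis x a) (bas c) +
          scale (koszul x a) (n2_bracket (bas a) (n2_bracket_basis x c))"
        using n2_jacobi_basis[of x a c] by (simp add: n2_bracket_simps)
      have sk: "n2_bracket (bas a) (n2_bracket_basis x c) = - scale (sgn2 (n2_par a * (n2_par x + n2_par c)))
          (n2_bracket (n2_bracket_basis x c) (bas a))"
        by (rule n2_bracket_skew[OF hom(2) hom(1)])
      show "tensor_map (n2_bracket (bas x)) id (scale (koszul c b) (n2_bracket_basis a c \<otimes> bas b \<otimes> bas d)) =
        ?H a b c d + - (n2_bracket (n2_bracket_basis x c) (bas a) \<otimes> bas b \<otimes> bas d)"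
        unfolding lin_scale[OF \<tau>] T jac sk tensor_simps scale_simps p
        by (cases "n2_par x"; cases "n2_par b"; cases "n2_par d"; simp add: scale_simps)
    qed
    also have "\<dots> = ?\<xi> (?\<xi> t3) + ?\<xi> t2"
      unfolding quad_add quad_minus \<xi>t3 \<xi>t2
      using quad_swap[of r "\<lambda>a b c d. n2_bracket (n2_bracket_basis x a) (bas c) \<otimes> bas d \<otimes> bas b"] by simp
    finally show ?thesis
      unfolding y_def cybe_quad lin_add[OF \<tau>] t1_def quad_add
      by (simp add: lin_quad[OF lin_tensor_map] lin_scale[OF \<tau>] T n2_bracket_simps add_ac)
  qed
  then show ?thesis
    unfolding t by (simp add: \<xi> super_cyclic_cubed add_ac)
qed

section \<open>Separation of supports\<close>

text \<open>
For the odd elements \<open>mode\<close> is half less than the degree, so \<open>ad x\<close> raises it by the mode of \<open>x\<close> or by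
one more.
\<close>

fun mode :: "n2_basis \<Rightarrow> int" where
  "mode (LL m) = m"
| "mode (II m) = m"
| "mode (GP k) = k"
| "mode (GM k) = k"

lemma coad_eq_0_by_mode:
  assumes "\<And>a. mode u - mode x - 1 \<le> mode a \<Longrightarrow> mode a \<le> mode u - mode x \<Longrightarrow> f a = 0"
  shows "coad x u f = 0"
  by (cases x; cases u) (simp_all add: assms)

text \<open>
No nonzero vector is annihilated by all \<open>ad x\<close> with \<open>x\<close> of large mode: \<open>L\<^sub>n\<close> detects \<open>L\<^sub>i\<close> and \<open>G\<^sup>\<plusminus>\<^sub>i\<close> as
soon as its coefficient in the bracket is nonzero, and then \<open>G\<^sup>+\<^sub>n\<close> detects \<open>I\<^sub>i\<close>.  (\<open>L\<^sub>n\<close> alone would not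
detect \<open>I\<^sub>0\<close>.)
\<close>

lemma eq_0_if_coad_eq_0:
  assumes "\<And>x u. mode x > N \<Longrightarrow> coad x u f = 0"
  shows "f a = 0"
proof -
  define n where "n = \<bar>N\<bar> + 2 * \<bar>mode a\<bar> + 2"
  have n: "n > N" "n \<noteq> mode a" "n \<noteq> 2 * mode a + 1" by (auto simp: n_def)
  have L: "f (LL (mode a)) = 0"
    using assms[of "LL n" "LL (n + mode a)"] n by simp
  have "of_int (n - (2 * mode a + 1)) * f (GP (mode a)) = 0" "of_int (n - (2 * mode a + 1)) * f (GM (mode a)) = 0"
    using assms[of "LL n" "GP (n + mode a)"] assms[of "LL n" "GM (n + mode a)"] n(1)
    by (auto simp: field_simps)
  then have "f (GP (mode a)) = 0" "f (GM (mode a)) = 0"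
    using n(3) by (auto simp del: of_int_diff of_int_add of_int_mult)
  moreover have "f (II (mode a)) = 0"
    using assms[of "GP n" "GP (n + mode a)"] n(1) L by simp
  ultimately show ?thesis using L by (cases a) simp_all
qed

text \<open>
Let all modes in \<open>c\<close> be at most \<open>N\<close> in absolute value and let the mode of \<open>x\<close> exceed \<open>2N + 1\<close>.  At a
coefficient \<open>(u, v, w)\<close> with \<open>v\<close> and \<open>w\<close> of mode at most \<open>N\<close> in absolute value, the two rotated
summands vanish: in them \<open>ad x\<close> has produced the factor \<open>v\<close> or \<open>w\<close>, which would then have mode greater
than \<open>N\<close>.  So the first summand vanishes by itself.
\<close>

lemma cyclic_sum_ad_eq_0D:
  fixes c :: "n2_basis \<times> n2_basis \<times> n2_basis \<Rightarrow>\<^sub>0 complex"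
  assumes "\<And>x. let y = tensor_map (n2_bracket (bas x)) id c in
     y + super_cyclic n2_par y + super_cyclic n2_par (super_cyclic n2_par y) = 0"
  shows "c = 0"
proof -
  let ?c = "Poly_Mapping.lookup c"
  obtain N where N: "\<And>u v w. ?c (u, v, w) \<noteq> 0 \<Longrightarrow> \<bar>mode u\<bar> \<le> N \<and> \<bar>mode v\<bar> \<le> N \<and> \<bar>mode w\<bar> \<le> N"
  proof -
    let ?S = "(\<lambda>(u, v, w). Max {\<bar>mode u\<bar>, \<bar>mode v\<bar>, \<bar>mode w\<bar>}) ` Poly_Mapping.keys c"
    have "\<bar>mode u\<bar> \<le> Max (insert 0 ?S) \<and> \<bar>mode v\<bar> \<le> Max (insert 0 ?S) \<and> \<bar>mode w\<bar> \<le> Max (insert 0 ?S)"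
      if "?c (u, v, w) \<noteq> 0" for u v w
    proof -
      have "Max {\<bar>mode u\<bar>, \<bar>mode v\<bar>, \<bar>mode w\<bar>} \<in> insert 0 ?S"
        using that by (intro insertI2 image_eqI[where x = "(u, v, w)"]) (auto simp: in_keys_iff)
      then have "Max {\<bar>mode u\<bar>, \<bar>mode v\<bar>, \<bar>mode w\<bar>} \<le> Max (insert 0 ?S)"
        by (intro Max_ge) auto
      then show ?thesis by auto
    qed
    then show thesis using that by blast
  qed
  have "coad x u (\<lambda>a. ?c (a, v, w)) = 0" if x: "mode x > 2 * \<bar>N\<bar> + 1" for x u v w
  proof (cases "\<bar>mode v\<bar> \<le> N \<and> \<bar>mode w\<bar> \<le> N")
    case False
    then have "?c (a, v, w) = 0" for a using N[of a v w] by blast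
    then show ?thesis by (simp add: coad_simps)
  next
    case True
    let ?y = "tensor_map (n2_bracket (bas x)) id c"
    have far: "coad x v' (\<lambda>a. ?c (a, w', u')) = 0" if "\<bar>mode v'\<bar> \<le> N" for u' v' w'
    proof (rule coad_eq_0_by_mode)
      fix a assume "mode a \<le> mode v' - mode x"
      with x that have "\<not> \<bar>mode a\<bar> \<le> N" by linarith
      then show "?c (a, w', u') = 0" using N[of a w' u'] by blast
    qed
    have "Poly_Mapping.lookup (?y + super_cyclic n2_par ?y + super_cyclic n2_par (super_cyclic n2_par ?y)) (u, v, w) = 0"
      using assms[of x] by (simp add: Let_def)
    then show ?thesis
      using True by (simp add: lookup_add lookup_super_cyclic lookup_tensor_map_bracket far)
  qed
  then have "?c (a, v, w) = 0" for a v w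
    using eq_0_if_coad_eq_0[of "2 * \<bar>N\<bar> + 1" "\<lambda>a. ?c (a, v, w)"] by blast
  then show "c = 0"
    by (intro poly_mapping_eqI) auto
qed

lemma even_skew_add: "even_skew r \<Longrightarrow> even_skew s \<Longrightarrow> even_skew (r + s)"
  unfolding even_skew_def[of "r + s"]
proof (intro conjI allI impI)
  fix u v assume *: "even_skew r" "even_skew s"
  show "Poly_Mapping.lookup (r + s) (v, u) = - koszul u v * Poly_Mapping.lookup (r + s) (u, v)"
    using even_skewD(1)[OF *(1), of v u] even_skewD(1)[OF *(2), of v u]
    by (simp add: lookup_add distrib_left)
  assume "n2_par u \<noteq> n2_par v"
  then show "Poly_Mapping.lookup (r + s) (u, v) = 0"
    using even_skewD(2)[OF *(1)] even_skewD(2)[OF *(2)] by (simp add: lookup_add)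
qed

section \<open>Lie superbialgebra structures on the algebra\<close>

theorem theorem4p1:
  fixes \<Delta> :: "(n2_basis \<Rightarrow>\<^sub>0 complex) \<Rightarrow> (n2_basis \<times> n2_basis \<Rightarrow>\<^sub>0 complex)"
  assumes "lie_superbialgebra n2_par n2_bracket \<Delta>"
  shows "\<exists>r \<in> im_one_minus_twist n2_par.
           \<Delta> = cobracket_of n2_par n2_bracket r \<and> cybe n2_par n2_bracket r = 0"
proof -
  have D: "skew_derivation \<Delta>" by (rule superbialgebra_skew_derivation[OF assms])
  obtain r1 where r1: "even_skew r1" "neutral (\<lambda>x. \<Delta> x - n2_diag x r1)"
    by (rule neutral_mod_inner[OF D])
  then have N1: "neutral_derivation (\<lambda>x. \<Delta> x - n2_diag x r1)"
    by (simp add: neutral_derivation_def skew_derivation_diff D skew_derivation_inner)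
  obtain r2 where r2: "even_skew r2" "neutral_derivation (\<lambda>x. \<Delta> x - n2_diag x r1 - n2_diag x r2)"
    and GG: "\<And>m k l. Poly_Mapping.lookup (\<Delta> (bas (II m)) - n2_diag (bas (II m)) r1 - n2_diag (bas (II m)) r2)
      (GP k, GM l) = 0"
    using inner_modulo_GG_part[OF N1] by blast
  let ?E = "\<lambda>x. \<Delta> x - n2_diag x r1 - n2_diag x r2"
  obtain r3 where r3: "even_skew r3"
    and norm: "neutral_derivation (\<lambda>x. ?E x - n2_diag x r3)"
    "\<And>m k l. Poly_Mapping.lookup (?E (bas (II m)) - n2_diag (bas (II m)) r3) (GP k, GM l) = 0"
    "\<And>m i j. Poly_Mapping.lookup (?E (bas (II m)) - n2_diag (bas (II m)) r3) (LL i, LL j) = 0"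
    "\<And>m i j. Poly_Mapping.lookup (?E (bas (II m)) - n2_diag (bas (II m)) r3) (LL i, II j) = 0"
    "\<And>k i j. Poly_Mapping.lookup (?E (bas (GP k)) - n2_diag (bas (GP k)) r3) (LL i, GP j) = 0"
    by (rule inner_modulo_L_parts[OF r2(2) GG]) blast
  obtain r4 where r4: "even_skew r4"
    and eq: "\<And>x. ?E x - n2_diag x r3 = n2_diag x r4"
    by (rule normalised_derivation_inner[OF norm]) blast
  define r where "r = r1 + r2 + r3 + r4"
  have r: "even_skew r"
    unfolding r_def by (intro even_skew_add r1 r2 r3 r4)
  have \<Delta>: "\<Delta> = (\<lambda>x. n2_diag x r)"
  proof
    fix x
    show "\<Delta> x = n2_diag x r"
      using eq[of x] by (simp add: r_def lin_add[OF lin_n2_diag(1)] diff_eq_eq add_ac)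
  qed
  have "let t = tensor_map id \<Delta> (\<Delta> (bas x)) in
      t + super_cyclic n2_par t + super_cyclic n2_par (super_cyclic n2_par t) = 0" for x
    using assms unfolding lie_superbialgebra_def by blast
  then have "cybe n2_par n2_bracket r = 0"
    using co_jacobi_sum_cybe[OF r] by (intro cyclic_sum_ad_eq_0D) (simp add: Let_def \<Delta>)
  then show ?thesis
    using even_skew_in_im_one_minus_twist[OF r] cobracket_of_even[OF r] \<Delta>
    by (intro bexI[of _ r]) simp_all
qed

end
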